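(* Let $f$ be a cuspidal edge at $p=\mathbf{0}\in\mathbf{R}^2$ given in the normal form $$f(u,v)=\Big(u,\ \tfrac{a_{20}}{2}u^2+\tfrac{a_{30}}{6}u^3+\tfrac{v^2}{2},\ \tfrac{b_{20}}{2}u^2+\tfrac{b_{30}}{6}u^3+\tfrac{b_{12}}{2}uv^2+\tfrac{b_{03}}{6}v^3\Big)+h(u,v)$$ (see the context), let $\mathbf{c}=(c_1,c_2,c_3)\in\mathbf{R}^3\setminus\{\mathbf 0\}$ satisfy $\langle\nu(\mathbf 0),\mathbf{c}\rangle\neq0$, and let $$\tilde h(u,v)=\langle \bar f(u,v),\mathbf{n}_0\rangle-r_0,\qquad \bar f=f+\mathbf{c},\quad \mathbf{n}_0=\nu(\mathbf 0)=(0,0,1),\quad r_0=\langle\bar f(\mathbf 0),\mathbf{n}_0\rangle=c_3.$$ Then the function $\tilde h$ has a $D_4$ singularity at $p=\mathbf 0$ if and only if $\hat\kappa_2(p)=0$, the edge inflectional curvature of $f$ does not vanish at $p$ (that is, $b_{30}\neq0$), and $p$ is not a ridge point of $f$.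
   Context: All maps are $C^\infty$. In the normal form, $a_{ij},b_{ij}$ are real constants with $b_{20}\ge0$, $b_{03}\neq0$, and $h(u,v)=(0,\,u^4h_1(u),\,u^4h_2(u)+u^2v^2h_3(u)+uv^3h_4(u)+v^4h_5(u,v))$ with $h_1,\dots,h_5$ smooth functions; $f$ is considered on a small neighborhood of $\mathbf 0$, where the singular set of $f$ is the $u$-axis. The coefficient $b_{30}$ is the edge inflectional curvature of $f$ at $\mathbf 0$. Write $f_v=v\psi$ with $\psi$ smooth and nowhere zero; $f_u,\psi$ are linearly independent and $\nu=f_u\times\psi/\|f_u\times\psi\|$ is the unit normal. Set $\hat E=\langle f_u,f_u\rangle$, $\hat F=\langle f_u,\psi\rangle$, $\hat G=\langle\psi,\psi\rangle$, $\hat L=-\langle f_u,\nu_u\rangle$, $\hat M=-\langle\psi,\nu_u\rangle$, $\hat N=-\langle\psi,\nu_v\rangle$, $\hat A=\hat E\hat N-2v\hat F\hat M+v\hat G\hat L$, $\hat B=\sqrt{\hat A^2-4v(\hat E\hat G-\hat F^2)(\hat L\hat N-v\hat M^2)}$ and $$\hat\kappa_2=\frac{\hat A-\hat B}{2v(\hat E\hat G-\hat F^2)}\quad(v\neq0).$$ Standing assumption: $\hat N>0$ on the $u$-axis (at the origin $\hat N(\mathbf 0)=b_{03}/2$, so $b_{03}>0$); then $\hat\kappa_2$ extends smoothly across the $u$-axis near $\mathbf 0$, and $\hat\kappa_2(\mathbf 0)=b_{20}$. The principal direction is $\hat{\boldsymbol v}=\xi\partial_u+\zeta\partial_v$ with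 $(\xi,\zeta)=(\hat N-v\hat\kappa_2\hat G,\,-\hat M+\hat\kappa_2\hat F)$. The point $\mathbf 0$ is a ridge point of $f$ if the directional derivative $\hat{\boldsymbol v}\hat\kappa_2$ vanishes at $\mathbf 0$. A function-germ has a $D_4$ singularity at $\mathbf 0$ if it is right equivalent (i.e. equal up to composition with a diffeomorphism-germ of the source) to $u^3+uv^2$ or to $u^3-uv^2$ at $\mathbf 0$. *)

theory Defs
  imports "HOL-Analysis.Analysis"
begin

section \<open>Smooth maps and smooth germs\<close>

primrec Ck_on :: "nat \<Rightarrow> 'a::real_normed_vector set \<Rightarrow> ('a \<Rightarrow> 'b::real_normed_vector) \<Rightarrow> bool" where
  "Ck_on 0 S f \<longleftrightarrow> continuous_on S f"
| "Ck_on (Suc k) S f \<longleftrightarrow> (\<forall>x\<in>S. f differentiable (at x)) \<and>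
     (\<forall>v. Ck_on k S (\<lambda>x. frechet_derivative f (at x) v))"

text \<open>Intended for open \<open>S\<close> and finite-dimensional domains, where it is the usual
  \<open>C\<^sup>\<infinity>\<close> condition: all iterated directional derivatives exist and are continuous.\<close>

definition smooth_on :: "'a::real_normed_vector set \<Rightarrow> ('a \<Rightarrow> 'b::real_normed_vector) \<Rightarrow> bool" where
  "smooth_on S f \<longleftrightarrow> (\<forall>k. Ck_on k S f)"

definition diffeo_germ :: "('a::real_normed_vector \<Rightarrow> 'b::real_normed_vector) \<Rightarrow> 'a \<Rightarrow> 'b \<Rightarrow> bool" where
  "diffeo_germ \<phi> p q \<longleftrightarrow> (\<exists>U V \<phi>'. open U \<and> open V \<and> p \<in> U \<and> \<phi> p = q \<and>
     homeomorphism U V \<phi> \<phi>' \<and> smooth_on U \<phi> \<and> smooth_on V \<phi>')"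

definition right_equivalent_at_0 :: "(real \<times> real \<Rightarrow> real) \<Rightarrow> (real \<times> real \<Rightarrow> real) \<Rightarrow> bool" where
  "right_equivalent_at_0 g k \<longleftrightarrow>
     (\<exists>\<phi>. diffeo_germ \<phi> 0 0 \<and> (\<forall>\<^sub>F x in nhds 0. g x = k (\<phi> x)))"

definition D4_singularity_at_0 :: "(real \<times> real \<Rightarrow> real) \<Rightarrow> bool" where
  "D4_singularity_at_0 g \<longleftrightarrow>
     right_equivalent_at_0 g (\<lambda>(u, v). u ^ 3 + u * v ^ 2) \<or>
     right_equivalent_at_0 g (\<lambda>(u, v). u ^ 3 - u * v ^ 2)"

definition cuspidal_edge_at :: "(real \<times> real \<Rightarrow> real ^ 3) \<Rightarrow> real \<times> real \<Rightarrow> bool" where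
  "cuspidal_edge_at f p \<longleftrightarrow> (\<exists>(\<phi> :: real \<times> real \<Rightarrow> real \<times> real) (\<Phi> :: real ^ 3 \<Rightarrow> real ^ 3).
     diffeo_germ \<phi> p 0 \<and> diffeo_germ \<Phi> (f p) 0 \<and>
     (\<forall>\<^sub>F x in nhds p. \<Phi> (f x) = (case \<phi> x of (u, v) \<Rightarrow> vector [u, v ^ 2, v ^ 3])))"

section \<open>Invariants of a cuspidal edge whose singular set is the \<open>u\<close>-axis\<close>

definition du :: "(real \<times> real \<Rightarrow> 'b::real_normed_vector) \<Rightarrow> real \<times> real \<Rightarrow> 'b" where
  "du g p = frechet_derivative g (at p) (1, 0)"

definition dv :: "(real \<times> real \<Rightarrow> 'b::real_normed_vector) \<Rightarrow> real \<times> real \<Rightarrow> 'b" where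
  "dv g p = frechet_derivative g (at p) (0, 1)"

text \<open>Extension by continuity across the \<open>u\<close>-axis of a map whose values off the axis are those
  of \<open>g\<close>; it is only meaningful where the limit exists.\<close>

definition extend_axis :: "(real \<times> real \<Rightarrow> 'b::real_normed_vector) \<Rightarrow> real \<times> real \<Rightarrow> 'b" where
  "extend_axis g p = (if snd p \<noteq> 0 then g p else Lim (at p within {q. snd q \<noteq> 0}) g)"

text \<open>The map \<open>\<psi>\<close> determined by \<open>f\<^sub>v = v \<psi>\<close> and continuity.\<close>

definition psi :: "(real \<times> real \<Rightarrow> real ^ 3) \<Rightarrow> real \<times> real \<Rightarrow> real ^ 3" where
  "psi f = extend_axis (\<lambda>p. dv f p /\<^sub>R snd p)"

definition nu :: "(real \<times> real \<Rightarrow> real ^ 3) \<Rightarrow> real \<times> real \<Rightarrow> real ^ 3" where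
  "nu f p = cross3 (du f p) (psi f p) /\<^sub>R norm (cross3 (du f p) (psi f p))"

definition E_hat :: "(real \<times> real \<Rightarrow> real ^ 3) \<Rightarrow> real \<times> real \<Rightarrow> real" where
  "E_hat f p = du f p \<bullet> du f p"

definition F_hat :: "(real \<times> real \<Rightarrow> real ^ 3) \<Rightarrow> real \<times> real \<Rightarrow> real" where
  "F_hat f p = du f p \<bullet> psi f p"

definition G_hat :: "(real \<times> real \<Rightarrow> real ^ 3) \<Rightarrow> real \<times> real \<Rightarrow> real" where
  "G_hat f p = psi f p \<bullet> psi f p"

definition L_hat :: "(real \<times> real \<Rightarrow> real ^ 3) \<Rightarrow> real \<times> real \<Rightarrow> real" where
  "L_hat f p = - (du f p \<bullet> du (nu f) p)"

definition M_hat :: "(real \<times> real \<Rightarrow> real ^ 3) \<Rightarrow> real \<times> real \<Rightarrow> real" where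
  "M_hat f p = - (psi f p \<bullet> du (nu f) p)"

definition N_hat :: "(real \<times> real \<Rightarrow> real ^ 3) \<Rightarrow> real \<times> real \<Rightarrow> real" where
  "N_hat f p = - (psi f p \<bullet> dv (nu f) p)"

definition A_hat :: "(real \<times> real \<Rightarrow> real ^ 3) \<Rightarrow> real \<times> real \<Rightarrow> real" where
  "A_hat f p = E_hat f p * N_hat f p - 2 * snd p * F_hat f p * M_hat f p
     + snd p * G_hat f p * L_hat f p"

definition B_hat :: "(real \<times> real \<Rightarrow> real ^ 3) \<Rightarrow> real \<times> real \<Rightarrow> real" where
  "B_hat f p = sqrt ((A_hat f p)\<^sup>2 - 4 * snd p * (E_hat f p * G_hat f p - (F_hat f p)\<^sup>2)
     * (L_hat f p * N_hat f p - snd p * (M_hat f p)\<^sup>2))"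

definition kappa2_hat :: "(real \<times> real \<Rightarrow> real ^ 3) \<Rightarrow> real \<times> real \<Rightarrow> real" where
  "kappa2_hat f = extend_axis (\<lambda>p. (A_hat f p - B_hat f p) /
     (2 * snd p * (E_hat f p * G_hat f p - (F_hat f p)\<^sup>2)))"

definition principal_direction :: "(real \<times> real \<Rightarrow> real ^ 3) \<Rightarrow> real \<times> real \<Rightarrow> real \<times> real" where
  "principal_direction f p = (N_hat f p - snd p * kappa2_hat f p * G_hat f p,
     - M_hat f p + kappa2_hat f p * F_hat f p)"

text \<open>The derivative is that of the extended function, which is smooth near the origin when
  \<open>N_hat\<close> is positive on the \<open>u\<close>-axis.\<close>

definition ridge_point :: "(real \<times> real \<Rightarrow> real ^ 3) \<Rightarrow> real \<times> real \<Rightarrow> bool" where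
  "ridge_point f p \<longleftrightarrow>
     frechet_derivative (kappa2_hat f) (at p) (principal_direction f p) = 0"

section \<open>Normal form and height function\<close>

definition normal_form ::
  "real \<Rightarrow> real \<Rightarrow> real \<Rightarrow> real \<Rightarrow> real \<Rightarrow> real \<Rightarrow> real \<times> real \<Rightarrow> real ^ 3" where
  "normal_form a20 a30 b20 b30 b12 b03 = (\<lambda>(u, v). vector
     [u,
      a20 / 2 * u ^ 2 + a30 / 6 * u ^ 3 + v ^ 2 / 2,
      b20 / 2 * u ^ 2 + b30 / 6 * u ^ 3 + b12 / 2 * u * v ^ 2 + b03 / 6 * v ^ 3])"

definition remainder ::
  "(real \<Rightarrow> real) \<Rightarrow> (real \<Rightarrow> real) \<Rightarrow> (real \<Rightarrow> real) \<Rightarrow> (real \<Rightarrow> real) \<Rightarrow>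
   (real \<times> real \<Rightarrow> real) \<Rightarrow> real \<times> real \<Rightarrow> real ^ 3" where
  "remainder h1 h2 h3 h4 h5 = (\<lambda>(u, v). vector
     [0,
      u ^ 4 * h1 u,
      u ^ 4 * h2 u + u ^ 2 * v ^ 2 * h3 u + u * v ^ 3 * h4 u + v ^ 4 * h5 (u, v)])"

definition height_function ::
  "(real \<times> real \<Rightarrow> real ^ 3) \<Rightarrow> real ^ 3 \<Rightarrow> real \<times> real \<Rightarrow> real" where
  "height_function f c p =
     (let fbar = (\<lambda>q. f q + c); n0 = nu f 0; r0 = fbar 0 \<bullet> n0 in fbar p \<bullet> n0 - r0)"

end

theory Submission
  imports Defs
begin

text \<open>
  Since \<open>\<nu>(0)\<close> is the third basis vector, the height function is the third coordinate of
  \<open>f\<close>. The remainder terms of the normal form only modify the coefficients of its cubic part, so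
  \<open>h = b\<^sub>2\<^sub>0 u\<^sup>2 / 2 + P u\<^sup>3 + Q u v\<^sup>2 + R v\<^sup>3\<close>
  with smooth functions \<open>P, Q, R\<close> of \<open>(u, v)\<close> whose values at the origin are \<open>b\<^sub>3\<^sub>0/6\<close>,
  \<open>b\<^sub>1\<^sub>2/2\<close>, \<open>b\<^sub>0\<^sub>3/6\<close>. The function has a \<open>D\<^sub>4\<close> singularity if and only if \<open>b\<^sub>2\<^sub>0 = 0\<close>
  and the binary cubic form with these values as coefficients has three distinct complex roots. As
  \<open>b\<^sub>0\<^sub>3\<close> is nonzero, the latter says \<open>b\<^sub>3\<^sub>0 \<noteq> 0\<close> and \<open>4 b\<^sub>1\<^sub>2\<^sup>3 + b\<^sub>3\<^sub>0 b\<^sub>0\<^sub>3\<^sup>2 \<noteq> 0\<close>.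

  Necessity (\<open>D4_singularity_imp_cubic\<close>): if \<open>h = k \<circ> \<phi>\<close> with \<open>k = u\<^sup>3 \<plusminus> u v\<^sup>2\<close> and a
  diffeomorphism germ \<open>\<phi>\<close> with linear part \<open>A\<close>, comparing the growth of both sides along lines
  through the origin shows \<open>b\<^sub>2\<^sub>0 = 0\<close> and that the cubic form equals \<open>k \<circ> A\<close>. The latter has no
  critical point except the origin, whereas a repeated linear factor would produce one.

  Sufficiency (\<open>D4_singularity_of_cubic\<close>): the diffeomorphism is explicit. For each point
  \<open>x\<close> near the origin, the cubic form with coefficients \<open>P x, 0, Q x, R x\<close> is carried to
  \<open>u\<^sup>3 \<plusminus> u v\<^sup>2\<close> by a linear map \<open>A(x)\<close>: split off a real linear factor, complete the square in the
  quadratic cofactor, and rescale. Distinctness of the roots makes \<open>A(x)\<close> smooth in \<open>x\<close>, and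
  \<open>\<phi>(x) = A(x) x\<close> is the required diffeomorphism germ.

  Invariants (\<open>kappa2_and_ridge\<close>): rationalising the numerator gives
  \<open>\<kappa> = 2 (L N - v M\<^sup>2) / (A + B)\<close> near the origin, which is smooth because \<open>A = B = N > 0\<close> at the origin.
  Hence \<open>\<kappa>(0) = b\<^sub>2\<^sub>0\<close>. When this vanishes, the derivative of \<open>\<kappa>\<close> at the origin along the principal
  direction \<open>(N, -M)\<close> is \<open>(N\<^sup>2 L\<^sub>u - N M L\<^sub>v + M\<^sup>3) / N\<close>. Substituting \<open>M = b\<^sub>1\<^sub>2\<close>,
  \<open>N = b\<^sub>0\<^sub>3/2\<close>, \<open>L\<^sub>u = b\<^sub>3\<^sub>0 - a\<^sub>2\<^sub>0 b\<^sub>1\<^sub>2\<close> and \<open>L\<^sub>v = - a\<^sub>2\<^sub>0 b\<^sub>0\<^sub>3/2\<close>, the terms in \<open>a\<^sub>2\<^sub>0\<close> cancel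
  and \<open>(4 b\<^sub>1\<^sub>2\<^sup>3 + b\<^sub>3\<^sub>0 b\<^sub>0\<^sub>3\<^sup>2) / (2 b\<^sub>0\<^sub>3)\<close> remains: being a ridge point is exactly the degeneracy
  of the cubic form.
\<close>

section \<open>Calculus of smooth maps\<close>

lemma differentiable_has_frechet:
  "f differentiable (at x) \<Longrightarrow> (f has_derivative frechet_derivative f (at x)) (at x)"
  by (simp add: frechet_derivative_works)

lemma Ck_on_Suc_imp: "Ck_on (Suc k) S f \<Longrightarrow> Ck_on k S f"
proof (induction k arbitrary: f)
  case 0
  then show ?case
    by (auto intro!: continuous_at_imp_continuous_on differentiable_imp_continuous_within)
next
  case (Suc k)
  then show ?case by (metis Ck_on.simps(2))
qed

lemma Ck_on_cong:
  assumes "open S" "Ck_on k S f" "\<And>x. x \<in> S \<Longrightarrow> f x = g x"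
  shows "Ck_on k S g"
  using assms(2,3)
proof (induction k arbitrary: f g)
  case 0
  then show ?case by (metis Ck_on.simps(1) continuous_on_cong)
next
  case (Suc k)
  have der: "(g has_derivative frechet_derivative f (at x)) (at x)" if "x \<in> S" for x
  proof (rule has_derivative_transform_within_open[OF _ \<open>open S\<close> that])
    show "(f has_derivative frechet_derivative f (at x)) (at x)"
      using Suc.prems(1) that by (auto intro: differentiable_has_frechet)
  qed (use Suc.prems(2) in auto)
  have "frechet_derivative f (at x) = frechet_derivative g (at x)" if "x \<in> S" for x
    using der[OF that] by (rule frechet_derivative_at)
  then have "Ck_on k S (\<lambda>x. frechet_derivative g (at x) v)" for v
    using Suc.IH[of "\<lambda>x. frechet_derivative f (at x) v"] Suc.prems(1) by simp
  with der show ?case unfolding Ck_on.simps differentiable_def by blast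
qed

text \<open>The derivative may be any formula that is correct on the set; as the set is open, the value that
  \<open>frechet_derivative\<close> has there is determined by it.\<close>

lemma Ck_on_SucI:
  assumes "open S"
    and der: "\<And>x. x \<in> S \<Longrightarrow> (f has_derivative f' x) (at x)"
    and "\<And>v. Ck_on k S (\<lambda>x. f' x v)"
  shows "Ck_on (Suc k) S f"
proof -
  have "f' x = frechet_derivative f (at x)" if "x \<in> S" for x
    using der[OF that] by (rule frechet_derivative_at)
  then have "Ck_on k S (\<lambda>x. frechet_derivative f (at x) v)" for v
    using Ck_on_cong[OF \<open>open S\<close> assms(3)[of v]] by simp
  with der show ?thesis unfolding Ck_on.simps differentiable_def by blast
qed

lemma Ck_on_SucD:
  assumes "Ck_on (Suc k) S f"
  shows "x \<in> S \<Longrightarrow> (f has_derivative frechet_derivative f (at x)) (at x)"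
    and "Ck_on k S (\<lambda>x. frechet_derivative f (at x) v)"
  using assms by (auto intro: differentiable_has_frechet)

lemma Ck_on_subset: "Ck_on k S f \<Longrightarrow> T \<subseteq> S \<Longrightarrow> Ck_on k T f"
proof (induction k arbitrary: f)
  case 0
  then show ?case by (auto intro: continuous_on_subset)
qed auto

lemma Ck_on_const: "open S \<Longrightarrow> Ck_on k S (\<lambda>x. c)"
proof (induction k arbitrary: c)
  case (Suc k)
  show ?case by (rule Ck_on_SucI[where f' = "\<lambda>x v. 0"]) (use Suc in auto)
qed auto

lemma Ck_on_id: "open S \<Longrightarrow> Ck_on k S (\<lambda>x. x)"
proof (cases k)
  case (Suc j)
  assume "open S"
  then show ?thesis unfolding Suc
    by (intro Ck_on_SucI[where f' = "\<lambda>x v. v"] Ck_on_const) auto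
qed auto

lemma Ck_on_bounded_linear:
  assumes "open S" "bounded_linear l" "Ck_on k S f"
  shows "Ck_on k S (\<lambda>x. l (f x))"
  using assms(3)
proof (induction k arbitrary: f)
  case 0
  then show ?case
    by (auto intro: bounded_linear.continuous_on[OF assms(2)])
next
  case (Suc k)
  show ?case
    using bounded_linear.has_derivative[OF assms(2) Ck_on_SucD(1)[OF Suc.prems]]
      Suc.IH[OF Ck_on_SucD(2)[OF Suc.prems]]
    by (intro Ck_on_SucI[OF \<open>open S\<close>])
qed

lemma Ck_on_add:
  assumes "open S" "Ck_on k S f" "Ck_on k S g"
  shows "Ck_on k S (\<lambda>x. f x + g x)"
  using assms(2,3)
proof (induction k arbitrary: f g)
  case 0
  then show ?case by (auto intro: continuous_on_add)
next
  case (Suc k)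
  show ?case
    using has_derivative_add[OF Ck_on_SucD(1)[OF Suc.prems(1)] Ck_on_SucD(1)[OF Suc.prems(2)]]
      Suc.IH[OF Ck_on_SucD(2)[OF Suc.prems(1)] Ck_on_SucD(2)[OF Suc.prems(2)]]
    by (intro Ck_on_SucI[OF \<open>open S\<close>])
qed

lemma Ck_on_sum:
  assumes "open S" "\<And>i. i \<in> I \<Longrightarrow> Ck_on k S (f i)"
  shows "Ck_on k S (\<lambda>x. \<Sum>i\<in>I. f i x)"
  using assms(2)
proof (induction I rule: infinite_finite_induct)
  case (insert i I)
  then show ?case by (simp add: Ck_on_add[OF \<open>open S\<close>])
qed (auto intro: Ck_on_const[OF \<open>open S\<close>])

text \<open>By the product rule the derivative is a sum of two terms of the same shape, so the induction has to
  range over both factors.\<close>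

lemma Ck_on_bilinear:
  assumes "open S" and B: "bounded_bilinear B" and "Ck_on k S f" "Ck_on k S g"
  shows "Ck_on k S (\<lambda>x. B (f x) (g x))"
  using assms(3,4)
proof (induction k arbitrary: f g)
  case 0
  then show ?case by (auto intro: bounded_bilinear.continuous_on[OF B])
next
  case (Suc k)
  note Df = Ck_on_SucD[OF Suc.prems(1)] and Dg = Ck_on_SucD[OF Suc.prems(2)]
  show ?case
  proof (rule Ck_on_SucI[OF \<open>open S\<close>])
    show "((\<lambda>x. B (f x) (g x)) has_derivative
       (\<lambda>v. B (f x) (frechet_derivative g (at x) v) + B (frechet_derivative f (at x) v) (g x))) (at x)"
      if "x \<in> S" for x
      by (rule bounded_bilinear.FDERIV[OF B Df(1)[OF that] Dg(1)[OF that]])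
    show "Ck_on k S (\<lambda>x. B (f x) (frechet_derivative g (at x) v)
          + B (frechet_derivative f (at x) v) (g x))" for v
      using Ck_on_add[OF \<open>open S\<close> Suc.IH[OF Ck_on_Suc_imp[OF Suc.prems(1)] Dg(2)]
          Suc.IH[OF Df(2) Ck_on_Suc_imp[OF Suc.prems(2)]]] .
  qed
qed

text \<open>Expanding the inner derivative in a basis turns the chain rule into a finite sum of products of
  directional derivatives of \<open>f\<close>, composed with \<open>g\<close>, and coordinates of derivatives of \<open>g\<close>. The
  induction hypothesis applies to the former.\<close>

lemma Ck_on_compose:
  fixes f :: "'b::euclidean_space \<Rightarrow> 'c::real_normed_vector"
    and g :: "'a::real_normed_vector \<Rightarrow> 'b"
  assumes "open S" and "open T" and "Ck_on k T f" "Ck_on k S g" and gST: "g ` S \<subseteq> T"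
  shows "Ck_on k S (\<lambda>x. f (g x))"
  using assms(3,4)
proof (induction k arbitrary: f)
  case 0
  then show ?case using gST by (auto intro: continuous_on_compose2)
next
  case (Suc k)
  note Df = Ck_on_SucD[OF Suc.prems(1)] and Dg = Ck_on_SucD[OF Suc.prems(2)]
  let ?D = "\<lambda>x v. \<Sum>b\<in>Basis. (frechet_derivative g (at x) v \<bullet> b) *\<^sub>R frechet_derivative f (at (g x)) b"
  show ?case
  proof (rule Ck_on_SucI[OF \<open>open S\<close>, of _ ?D])
    fix x assume x: "x \<in> S"
    have f: "(f has_derivative frechet_derivative f (at (g x))) (at (g x))"
      using x gST by (intro Df(1)) auto
    have lin: "linear (frechet_derivative f (at (g x)))"
      using has_derivative_linear[OF f] .
    have "frechet_derivative f (at (g x)) (frechet_derivative g (at x) v) = ?D x v" for v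
      by (subst (1) euclidean_representation[of "frechet_derivative g (at x) v", symmetric])
        (simp add: linear_sum[OF lin] linear_cmul[OF lin])
    then have "?D x = (\<lambda>v. frechet_derivative f (at (g x)) (frechet_derivative g (at x) v))"
      by auto
    with has_derivative_compose[OF Dg(1)[OF x] f]
    show "((\<lambda>x. f (g x)) has_derivative ?D x) (at x)" by simp
  next
    fix v
    show "Ck_on k S (\<lambda>x. ?D x v)"
      by (intro Ck_on_sum Ck_on_bilinear[OF _ bounded_bilinear_scaleR]
          Ck_on_bounded_linear[OF _ bounded_linear_inner_left] \<open>open S\<close> Dg(2) Suc.IH Df(2)
          Ck_on_Suc_imp[OF Suc.prems(2)])
  qed
qed

text \<open>The derivative \<open>- 1 / x\<^sup>2\<close> is a product of two copies of the function itself.\<close>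

lemma Ck_on_inverse: "Ck_on k (- {0}) (inverse :: real \<Rightarrow> real)"
proof (induction k)
  case 0
  show ?case by (auto intro!: continuous_intros)
next
  case (Suc k)
  have o: "open (- {0::real})" by auto
  show ?case
  proof (rule Ck_on_SucI[OF o])
    show "(inverse has_derivative (\<lambda>v. - v * (inverse x * inverse x))) (at x)"
      if "x \<in> - {0}" for x :: real
      using that by (auto intro!: derivative_eq_intros simp: algebra_simps)
    show "Ck_on k (- {0::real}) (\<lambda>x. - v * (inverse x * inverse x))" for v
      by (intro Ck_on_bilinear[OF o bounded_bilinear_mult] Ck_on_const o Suc)
  qed
qed

lemma Ck_on_powr: "Ck_on k {0<..} (\<lambda>x::real. x powr r)"
proof (induction k arbitrary: r)
  case 0
  show ?case by (auto intro!: continuous_intros)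
next
  case (Suc k)
  show ?case
  proof (rule Ck_on_SucI)
    show "((\<lambda>x. x powr r) has_derivative (\<lambda>v. v * r * x powr (r - 1))) (at x)"
      if "x \<in> {0<..}" for x :: real
      using that
      by (auto intro!: derivative_eq_intros simp: algebra_simps powr_diff)
    show "Ck_on k {0<..} (\<lambda>x::real. v * r * x powr (r - 1))" for v
      by (intro Ck_on_bilinear[OF _ bounded_bilinear_mult] Ck_on_const Suc) auto
  qed auto
qed

lemma smooth_on_cong:
  "open S \<Longrightarrow> smooth_on S f \<Longrightarrow> (\<And>x. x \<in> S \<Longrightarrow> f x = g x) \<Longrightarrow> smooth_on S g"
  using Ck_on_cong[of S _ f g] by (simp add: smooth_on_def)

lemma smooth_on_subset: "smooth_on S f \<Longrightarrow> T \<subseteq> S \<Longrightarrow> smooth_on T f"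
  using Ck_on_subset[of _ S f T] by (simp add: smooth_on_def)

lemma smooth_on_const: "open S \<Longrightarrow> smooth_on S (\<lambda>x. c)"
  using Ck_on_const[of S _ c] by (simp add: smooth_on_def)

lemma smooth_on_id: "open S \<Longrightarrow> smooth_on S (\<lambda>x. x)"
  using Ck_on_id[of S] by (simp add: smooth_on_def)

lemma smooth_on_bounded_linear:
  "open S \<Longrightarrow> bounded_linear l \<Longrightarrow> smooth_on S f \<Longrightarrow> smooth_on S (\<lambda>x. l (f x))"
  using Ck_on_bounded_linear[of S l _ f] by (simp add: smooth_on_def)

lemma smooth_on_add:
  "open S \<Longrightarrow> smooth_on S f \<Longrightarrow> smooth_on S g \<Longrightarrow> smooth_on S (\<lambda>x. f x + g x)"
  using Ck_on_add[of S _ f g] by (simp add: smooth_on_def)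

lemma smooth_on_bilinear:
  "open S \<Longrightarrow> bounded_bilinear B \<Longrightarrow> smooth_on S f \<Longrightarrow> smooth_on S g \<Longrightarrow> smooth_on S (\<lambda>x. B (f x) (g x))"
  using Ck_on_bilinear[of S B _ f g] by (simp add: smooth_on_def)

lemma smooth_on_compose:
  fixes f :: "'b::euclidean_space \<Rightarrow> 'c::real_normed_vector"
  shows "open S \<Longrightarrow> open T \<Longrightarrow> smooth_on T f \<Longrightarrow> smooth_on S g \<Longrightarrow> g ` S \<subseteq> T
    \<Longrightarrow> smooth_on S (\<lambda>x. f (g x))"
  using Ck_on_compose[of S T _ f g] by (simp add: smooth_on_def)

lemma smooth_on_minus: "open S \<Longrightarrow> smooth_on S f \<Longrightarrow> smooth_on S (\<lambda>x. - f x)"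
  by (rule smooth_on_bounded_linear[OF _ bounded_linear_minus[OF bounded_linear_ident]])

lemma smooth_on_diff:
  "open S \<Longrightarrow> smooth_on S f \<Longrightarrow> smooth_on S g \<Longrightarrow> smooth_on S (\<lambda>x. f x - g x)"
  using smooth_on_add[of S f "\<lambda>x. - g x"] smooth_on_minus[of S g] by simp

lemma smooth_on_fst: "open S \<Longrightarrow> smooth_on S f \<Longrightarrow> smooth_on S (\<lambda>x. fst (f x))"
  by (rule smooth_on_bounded_linear[OF _ bounded_linear_fst])

lemma smooth_on_snd: "open S \<Longrightarrow> smooth_on S f \<Longrightarrow> smooth_on S (\<lambda>x. snd (f x))"
  by (rule smooth_on_bounded_linear[OF _ bounded_linear_snd])

lemma smooth_on_Pair:
  assumes "open S" "smooth_on S f" "smooth_on S g"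
  shows "smooth_on S (\<lambda>x. (f x, g x))"
proof -
  have "smooth_on S (\<lambda>x. (f x, 0) + (0, g x))"
    by (intro smooth_on_add \<open>open S\<close>
        smooth_on_bounded_linear[where f = f and l = "\<lambda>a. (a, 0)"]
        smooth_on_bounded_linear[where f = g and l = "\<lambda>a. (0, a)"]
        bounded_linear_Pair bounded_linear_ident bounded_linear_zero assms)
  then show ?thesis by simp
qed

lemmas smooth_on_mult = smooth_on_bilinear[OF _ bounded_bilinear_mult]
lemmas smooth_on_scaleR = smooth_on_bilinear[OF _ bounded_bilinear_scaleR]
lemmas smooth_on_inner = smooth_on_bilinear[OF _ bounded_bilinear_inner]

lemma smooth_on_cross3:
  "open S \<Longrightarrow> smooth_on S f \<Longrightarrow> smooth_on S g \<Longrightarrow> smooth_on S (\<lambda>x. cross3 (f x) (g x))"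
  by (rule smooth_on_bilinear[OF _ bilinear_cross[unfolded bilinear_conv_bounded_bilinear]])

lemma smooth_on_power:
  fixes f :: "'a::real_normed_vector \<Rightarrow> real"
  assumes "open S" "smooth_on S f" 
  shows "smooth_on S (\<lambda>x. f x ^ n)"
  by (induction n) (auto intro: smooth_on_const smooth_on_mult assms)

lemma smooth_on_inverse:
  fixes f :: "'a::real_normed_vector \<Rightarrow> real"
  assumes "open S" "smooth_on S f" "\<And>x. x \<in> S \<Longrightarrow> f x \<noteq> 0"
  shows "smooth_on S (\<lambda>x. inverse (f x))"
  by (rule smooth_on_compose[where T = "- {0}"])
    (use assms in \<open>auto simp: smooth_on_def Ck_on_inverse\<close>)

lemma smooth_on_divide:
  fixes f g :: "'a::real_normed_vector \<Rightarrow> real"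
  assumes "open S" "smooth_on S f" "smooth_on S g" "\<And>x. x \<in> S \<Longrightarrow> g x \<noteq> 0"
  shows "smooth_on S (\<lambda>x. f x / g x)"
  unfolding divide_inverse by (intro smooth_on_mult smooth_on_inverse assms)

lemma smooth_on_powr:
  fixes f :: "'a::real_normed_vector \<Rightarrow> real"
  assumes "open S" "smooth_on S f" "\<And>x. x \<in> S \<Longrightarrow> f x > 0"
  shows "smooth_on S (\<lambda>x. f x powr r)"
  by (rule smooth_on_compose[where T = "{0<..}" and f = "\<lambda>x. x powr r"])
    (use assms in \<open>auto simp: smooth_on_def Ck_on_powr\<close>)

lemma smooth_on_sqrt:
  fixes f :: "'a::real_normed_vector \<Rightarrow> real"
  assumes "open S" "smooth_on S f" "\<And>x. x \<in> S \<Longrightarrow> f x > 0"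
  shows "smooth_on S (\<lambda>x. sqrt (f x))"
  by (rule smooth_on_cong[OF _ smooth_on_powr[OF assms, where r = "1/2"]])
    (use assms in \<open>auto simp: powr_half_sqrt less_imp_le\<close>)

lemma smooth_on_norm:
  fixes f :: "'a::real_normed_vector \<Rightarrow> 'b::real_inner"
  assumes "open S" "smooth_on S f" "\<And>x. x \<in> S \<Longrightarrow> f x \<noteq> 0"
  shows "smooth_on S (\<lambda>x. norm (f x))"
  unfolding norm_eq_sqrt_inner
  by (intro smooth_on_sqrt smooth_on_inner) (use assms in auto)

lemma smooth_on_has_derivative:
  "smooth_on S f \<Longrightarrow> x \<in> S \<Longrightarrow> (f has_derivative frechet_derivative f (at x)) (at x)"
  using Ck_on_SucD(1)[of 0 S f x] unfolding smooth_on_def by blast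

lemma smooth_on_frechet: "smooth_on S f \<Longrightarrow> smooth_on S (\<lambda>x. frechet_derivative f (at x) v)"
  using Ck_on_SucD(2)[of _ S f v] unfolding smooth_on_def by blast

lemma smooth_on_du: "smooth_on S f \<Longrightarrow> smooth_on S (du f)"
  and smooth_on_dv: "smooth_on S f \<Longrightarrow> smooth_on S (dv f)"
  unfolding du_def[abs_def] dv_def[abs_def] by (rule smooth_on_frechet, assumption)+

lemma smooth_on_imp_continuous_on: "smooth_on S f \<Longrightarrow> continuous_on S f"
  using Ck_on.simps(1)[of S f] unfolding smooth_on_def by blast

lemmas smooth_intros = smooth_on_const smooth_on_id smooth_on_add smooth_on_diff smooth_on_minus
  smooth_on_mult smooth_on_scaleR smooth_on_inner smooth_on_cross3 smooth_on_power smooth_on_fst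
  smooth_on_snd smooth_on_Pair smooth_on_du smooth_on_dv

section \<open>Smooth inverse functions in the plane\<close>

definition jacobian :: "(real \<times> real \<Rightarrow> real \<times> real) \<Rightarrow> real \<times> real \<Rightarrow> real" where
  "jacobian \<phi> x = fst (du \<phi> x) * snd (dv \<phi> x) - fst (dv \<phi> x) * snd (du \<phi> x)"

lemma frechet_eq_du_dv:
  assumes "(g has_derivative frechet_derivative g (at p)) (at p)"
  shows "frechet_derivative g (at p) t = fst t *\<^sub>R du g p + snd t *\<^sub>R dv g p"
proof -
  have lin: "linear (frechet_derivative g (at p))"
    using has_derivative_linear[OF assms] .
  have "t = fst t *\<^sub>R (1, 0) + snd t *\<^sub>R (0, 1)"
    by (simp add: prod_eq_iff)
  then have "frechet_derivative g (at p) t =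
      frechet_derivative g (at p) (fst t *\<^sub>R (1, 0) + snd t *\<^sub>R (0, 1))"
    by (rule arg_cong)
  also have "\<dots> = fst t *\<^sub>R du g p + snd t *\<^sub>R dv g p"
    unfolding du_def dv_def linear_add[OF lin] linear_cmul[OF lin] ..
  finally show ?thesis .
qed

lemma smooth_on_has_derivative_du_dv:
  assumes "smooth_on S g" "p \<in> S"
  shows "(g has_derivative (\<lambda>t. fst t *\<^sub>R du g p + snd t *\<^sub>R dv g p)) (at p)"
  using smooth_on_has_derivative[OF assms]
    frechet_eq_du_dv[OF smooth_on_has_derivative[OF assms], abs_def]
  by simp

text \<open>The inverse is differentiable by the \<open>C\<^sup>1\<close> theorem. Its derivative is a rational expression, given
  by Cramer's rule, in the partial derivatives of \<open>\<phi>\<close> at the preimage. So if the inverse is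
  \<open>C\<^sup>k\<close>, its derivative is \<open>C\<^sup>k\<close> as well, and smoothness follows by induction.\<close>

lemma plane_inverse_function_theorem:
  fixes \<phi> :: "real \<times> real \<Rightarrow> real \<times> real"
  assumes "open W" and "p \<in> W" and sm: "smooth_on W \<phi>" and "jacobian \<phi> p \<noteq> 0"
  obtains U V \<phi>' where "open U" "U \<subseteq> W" "p \<in> U" "open V" "\<phi> p \<in> V"
    "homeomorphism U V \<phi> \<phi>'" "smooth_on V \<phi>'"
proof -
  define W1 where "W1 = W \<inter> {x. jacobian \<phi> x \<noteq> 0}"
  have smJ: "smooth_on W (jacobian \<phi>)"
    unfolding jacobian_def[abs_def] by (intro smooth_intros \<open>open W\<close> sm)
  have "open W1"
    unfolding W1_def using continuous_open_preimage[OF smooth_on_imp_continuous_on[OF smJ] \<open>open W\<close>, of "- {0}"]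
    by (auto simp: vimage_def Int_def)
  have "p \<in> W1" using assms by (auto simp: W1_def)
  have W1: "smooth_on W1 \<phi>" by (rule smooth_on_subset[OF sm]) (auto simp: W1_def)
  have J0: "jacobian \<phi> x \<noteq> 0" if "x \<in> W1" for x using that by (auto simp: W1_def)
  define D where "D x t = fst t *\<^sub>R du \<phi> x + snd t *\<^sub>R dv \<phi> x" for x t
  \<comment> \<open>Cramer's rule for the inverse of the derivative \<open>D x\<close>.\<close>
  define I where "I x t = ((snd (dv \<phi> x) * fst t - fst (dv \<phi> x) * snd t) / jacobian \<phi> x,
     (fst (du \<phi> x) * snd t - snd (du \<phi> x) * fst t) / jacobian \<phi> x)" for x t
  have ID: "I x (D x t) = t" and DI: "D x (I x t) = t" if "x \<in> W1" for x t
    using J0[OF that]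
    by (auto simp: I_def D_def prod_eq_iff divide_simps) (simp_all add: jacobian_def algebra_simps)
  have blD: "bounded_linear (D x)" for x
    unfolding D_def by (intro bounded_linear_intros)
  have blI: "bounded_linear (I x)" for x
    unfolding I_def divide_inverse by (intro bounded_linear_intros)
  have derD: "(\<phi> has_derivative blinfun_apply (Blinfun (D x))) (at x)" if "x \<in> W1" for x
    using smooth_on_has_derivative_du_dv[OF W1 that]
    unfolding bounded_linear_Blinfun_apply[OF blD] by (simp add: D_def[abs_def])
  have cont: "continuous_on W1 (\<lambda>x. Blinfun (D x))"
  proof (rule continuous_on_blinfun_componentwise)
    fix i :: "real \<times> real"
    show "continuous_on W1 (\<lambda>x. blinfun_apply (Blinfun (D x)) i)"
      unfolding bounded_linear_Blinfun_apply[OF blD] D_def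
      by (intro smooth_on_imp_continuous_on smooth_intros W1 \<open>open W1\<close>)
  qed
  have inv: "Blinfun (I p) o\<^sub>L Blinfun (D p) = id_blinfun"
    by (rule blinfun_eqI) (simp add: bounded_linear_Blinfun_apply blD blI ID \<open>p \<in> W1\<close>)
  obtain U V g g' where U: "open U" "U \<subseteq> W1" "p \<in> U" and V: "open V" "\<phi> p \<in> V"
    and hom: "homeomorphism U V \<phi> g"
    and derg: "\<And>y. y \<in> V \<Longrightarrow> (g has_derivative (g' y)) (at y)"
    and g': "\<And>y. y \<in> V \<Longrightarrow> g' y = inv (blinfun_apply (Blinfun (D (g y))))"
    by (rule inverse_function_theorem[OF \<open>open W1\<close> derD cont \<open>p \<in> W1\<close> inv]) blast+
  have gV: "g ` V = U" using hom by (auto simp: homeomorphism_def)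
  have g'I: "g' y = I (g y)" if "y \<in> V" for y
  proof -
    have "g y \<in> W1" using that gV U(2) by auto
    then show ?thesis
      unfolding g'[OF that] bounded_linear_Blinfun_apply[OF blD]
      by (intro inv_unique_comp) (auto simp: ID DI)
  qed
  have "Ck_on k V g" for k
  proof (induction k)
    case 0
    show ?case using hom by (auto simp: homeomorphism_def)
  next
    case (Suc k)
    show ?case
    proof (rule Ck_on_SucI[OF \<open>open V\<close>])
      show "(g has_derivative (I (g y))) (at y)" if "y \<in> V" for y
        using derg[OF that] g'I[OF that] by simp
      fix t
      have "smooth_on W1 (\<lambda>x. I x t)"
        unfolding I_def
        by (intro smooth_on_divide smooth_intros W1 \<open>open W1\<close> J0 smooth_on_subset[OF smJ])
          (auto simp: W1_def)
      then show "Ck_on k V (\<lambda>y. I (g y) t)"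
        using Ck_on_compose[OF \<open>open V\<close> \<open>open W1\<close> _ Suc, of "\<lambda>x. I x t"] gV U(2)
        by (auto simp: smooth_on_def)
    qed
  qed
  then have "smooth_on V g" by (simp add: smooth_on_def)
  moreover have "U \<subseteq> W" using U(2) by (auto simp: W1_def)
  ultimately show ?thesis using that[OF U(1) _ U(3) V hom] by blast
qed

text \<open>The coefficient \<open>q\<close> of \<open>t\<^sup>3 + p t + q\<close> is a function of \<open>p\<close> and of the root, and this
  change of coordinates is invertible as long as the root is simple.\<close>

lemma smooth_simple_root:
  fixes P Q :: "real \<times> real \<Rightarrow> real"
  assumes "open W" and "0 \<in> W" and P: "smooth_on W P" and Q: "smooth_on W Q"
    and root: "s0 ^ 3 + P 0 * s0 + Q 0 = 0" and simple: "3 * s0\<^sup>2 + P 0 \<noteq> 0"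
  obtains W' s where "open W'" "0 \<in> W'" "W' \<subseteq> W" "smooth_on W' s" "s 0 = s0"
    "\<And>x. x \<in> W' \<Longrightarrow> s x ^ 3 + P x * s x + Q x = 0"
proof -
  define \<theta> :: "real \<times> real \<Rightarrow> real \<times> real" where "\<theta> = (\<lambda>x. (snd x, - (fst x ^ 3 + snd x * fst x)))"
  have sm: "smooth_on UNIV \<theta>"
    unfolding \<theta>_def
    by (intro smooth_on_Pair smooth_on_minus smooth_on_add smooth_on_mult smooth_on_power
        smooth_on_fst smooth_on_snd smooth_on_id open_UNIV)
  have der: "(\<theta> has_derivative (\<lambda>t. (snd t, - (3 * fst x ^ 2 * fst t + snd x * fst t + snd t * fst x)))) (at x)" for x
    unfolding \<theta>_def by (rule derivative_eq_intros refl)+ (simp add: fun_eq_iff algebra_simps)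
  have "jacobian \<theta> (s0, P 0) = 3 * s0\<^sup>2 + P 0"
    by (simp add: jacobian_def du_def dv_def frechet_derivative_at[OF der, symmetric])
  with simple have "jacobian \<theta> (s0, P 0) \<noteq> 0" by simp
  then obtain U V \<theta>' where U: "(s0, P 0) \<in> U" and V: "open V" "\<theta> (s0, P 0) \<in> V"
    and hom: "homeomorphism U V \<theta> \<theta>'" and sm': "smooth_on V \<theta>'"
    by (rule plane_inverse_function_theorem[OF open_UNIV UNIV_I sm])
  define W' where "W' = W \<inter> (\<lambda>x. (P x, Q x)) -` V"
  have smPQ: "smooth_on W (\<lambda>x. (P x, Q x))" by (intro smooth_intros assms)
  have W': "open W'" "W' \<subseteq> W"
    unfolding W'_def
    using continuous_open_preimage[OF smooth_on_imp_continuous_on[OF smPQ] \<open>open W\<close> \<open>open V\<close>]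
    by (auto simp: vimage_def)
  have \<theta>0: "\<theta> (s0, P 0) = (P 0, Q 0)" using root by (simp add: \<theta>_def)
  have "0 \<in> W'" using V(2) \<open>0 \<in> W\<close> by (simp add: W'_def \<theta>0)
  define s where "s x = fst (\<theta>' (P x, Q x))" for x
  have sms: "smooth_on W' s"
    unfolding s_def
    by (intro smooth_on_fst smooth_on_compose[OF _ V(1) sm'] smooth_on_subset[OF smPQ] W')
      (auto simp: W'_def)
  have s0: "s 0 = s0"
    using homeomorphism_apply1[OF hom U] by (simp add: s_def \<theta>0)
  have "s x ^ 3 + P x * s x + Q x = 0" if "x \<in> W'" for x
  proof -
    have "\<theta> (\<theta>' (P x, Q x)) = (P x, Q x)"
      using that by (intro homeomorphism_apply2[OF hom]) (auto simp: W'_def)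
    then show ?thesis by (auto simp: \<theta>_def s_def)
  qed
  with that[OF W'(1) \<open>0 \<in> W'\<close> W'(2) sms s0] show ?thesis by blast
qed

section \<open>Nondegenerate cubics are \<open>D\<^sub>4\<close>\<close>

text \<open>The cubic changes sign between \<open>- M\<close> and \<open>M\<close> for \<open>M = 1 + |p| + |q|\<close>.\<close>

lemma depressed_cubic_real_root:
  fixes p q :: real
  obtains s where "s ^ 3 + p * s + q = 0"
proof -
  define M where "M = 1 + \<bar>p\<bar> + \<bar>q\<bar>"
  have M: "M \<ge> 1" by (simp add: M_def)
  have *: "M * \<bar>p\<bar> + \<bar>q\<bar> < M ^ 3"
  proof -
    have "M * \<bar>p\<bar> + \<bar>q\<bar> \<le> M * (\<bar>p\<bar> + \<bar>q\<bar>)"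
      using M mult_right_mono[of 1 M "\<bar>q\<bar>"] by (simp add: algebra_simps)
    also have "\<dots> < M * M" using M by (intro mult_strict_left_mono) (auto simp: M_def)
    also have "\<dots> \<le> M * M * M" using M mult_left_mono[of 1 M "M * M"] by simp
    finally show ?thesis by (simp add: power3_eq_cube)
  qed
  have b: "- (M * \<bar>p\<bar>) \<le> M * p" "M * p \<le> M * \<bar>p\<bar>"
    using M mult_left_mono[of "- \<bar>p\<bar>" p M] mult_left_mono[of p "\<bar>p\<bar>" M] by auto
  have "(- M) ^ 3 + p * (- M) + q \<le> 0" "0 \<le> M ^ 3 + p * M + q"
    using * b by (auto simp: mult.commute) 
  moreover have "continuous_on {-M..M} (\<lambda>s. s ^ 3 + p * s + q)"
    by (intro continuous_intros)
  ultimately have "\<exists>s. - M \<le> s \<and> s \<le> M \<and> s ^ 3 + p * s + q = 0"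
    using M by (intro IVT') auto
  then show ?thesis using that by blast
qed

text \<open>The first quantity is the derivative of the cubic at the root \<open>s\<close>. The second is, up to sign, the
  discriminant of the quadratic cofactor \<open>t\<^sup>2 + s t + (s\<^sup>2 + p)\<close>. If either vanished, the cubic would
  have a repeated root.\<close>

lemma cubic_root_multiplicity:
  fixes p q s :: real
  assumes "s ^ 3 + p * s + q = 0" and disc: "4 * p ^ 3 + 27 * q\<^sup>2 \<noteq> 0"
  shows "3 * s\<^sup>2 + p \<noteq> 0" and "3 * s\<^sup>2 + 4 * p \<noteq> 0"
proof -
  have q: "q = - (s ^ 3) - p * s" using assms(1) by simp
  show "3 * s\<^sup>2 + p \<noteq> 0"
  proof
    assume "3 * s\<^sup>2 + p = 0"
    then have "p = - 3 * s\<^sup>2" by simp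
    then show False using disc unfolding q
      by (simp add: power2_eq_square power3_eq_cube algebra_simps)
  qed
  show "3 * s\<^sup>2 + 4 * p \<noteq> 0"
  proof
    assume "3 * s\<^sup>2 + 4 * p = 0"
    then have "p = - (3 / 4) * s\<^sup>2" by simp
    then show False using disc unfolding q
      by (simp add: power2_eq_square power3_eq_cube algebra_simps)
  qed
qed

text \<open>The form has the linear factor \<open>y = u - s v\<close>. In the coordinates \<open>(y, v)\<close> its cofactor is
  \<open>y\<^sup>2 + 3 s y v + (3 s\<^sup>2 + p) v\<^sup>2\<close>, and \<open>z\<close> completes the square in \<open>v\<close>.\<close>

lemma cubic_as_cube_plus_square:
  fixes P p q s u v :: real
  assumes "s ^ 3 + p * s + q = 0" and e: "3 * s\<^sup>2 + p \<noteq> 0"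
  defines "y \<equiv> u - s * v"
  defines "z \<equiv> v + 3 * s / (2 * (3 * s\<^sup>2 + p)) * y"
  shows "P * (u ^ 3 + p * u * v\<^sup>2 + q * v ^ 3) =
    P * (3 * s\<^sup>2 + 4 * p) / (4 * (3 * s\<^sup>2 + p)) * y ^ 3 + P * (3 * s\<^sup>2 + p) * y * z\<^sup>2"
proof -
  have q: "q = - (s ^ 3) - p * s" and u: "u = y + s * v"
    using assms(1) by (simp_all add: y_def)
  define d where "d = 3 * s\<^sup>2 + p"
  have d: "d \<noteq> 0" and p: "p = d - 3 * s\<^sup>2" using e by (simp_all add: d_def)
  have z: "z = v + 3 * s / (2 * d) * y" by (simp add: z_def d_def)
  have "(3 * s\<^sup>2 + 4 * p) / (4 * d) * y ^ 3 + d * y * z\<^sup>2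
    = y ^ 3 + 3 * s * y\<^sup>2 * v + d * y * v\<^sup>2"
    using d unfolding z p by (simp add: field_simps power2_eq_square power3_eq_cube)
  also have "\<dots> = u ^ 3 + p * u * v\<^sup>2 + q * v ^ 3"
    unfolding u q p by (simp add: algebra_simps power2_eq_square power3_eq_cube)
  finally show ?thesis unfolding d_def[symmetric]
    by (metis (no_types, opaque_lifting) distrib_left mult.assoc times_divide_eq_right)
qed

text \<open>A factor that vanishes at the point leaves only one term of the product rule. Thus coefficients
  that depend on the point do not affect the linear part of a coordinate change \<open>x \<mapsto> A(x) x\<close> at
  the origin.\<close>

lemma has_derivative_mult_at_zero:
  fixes a b :: "'a::real_normed_vector \<Rightarrow> real"
  assumes "(a has_derivative a') (at x)" "(b has_derivative b') (at x)" "b x = 0"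
  shows "((\<lambda>x. a x * b x) has_derivative (\<lambda>t. a x * b' t)) (at x)"
  using has_derivative_mult[OF assms(1,2)] assms(3) by simp

abbreviation D4_form :: "real \<Rightarrow> real \<times> real \<Rightarrow> real" where
  "D4_form \<epsilon> \<equiv> (\<lambda>(u, v). u ^ 3 + \<epsilon> * (u * v\<^sup>2))"

lemma D4_singularity_iff:
  "D4_singularity_at_0 g \<longleftrightarrow> (\<exists>\<epsilon>. \<epsilon>\<^sup>2 = 1 \<and> right_equivalent_at_0 g (D4_form \<epsilon>))"
proof -
  have "(\<lambda>(u, v). u ^ 3 - u * v ^ 2) = D4_form (- 1)" "(\<lambda>(u, v). u ^ 3 + u * v ^ 2) = D4_form 1"
    by (simp_all add: fun_eq_iff)
  then show ?thesis
    unfolding D4_singularity_at_0_def power2_eq_1_iff by (simp only:) blast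
qed

lemma eventually_nhds_pos:
  fixes f :: "'a::real_normed_vector \<Rightarrow> real"
  assumes "continuous_on W f" "open W" "x \<in> W" "f x > 0"
  shows "\<forall>\<^sub>F y in nhds x. f y > 0"
proof -
  have "(f \<longlongrightarrow> f x) (nhds x)"
    using assms(1,3) continuous_on_eq_continuous_at[OF assms(2), of f]
    unfolding tendsto_at_iff_tendsto_nhds[symmetric] isCont_def by blast
  then show ?thesis using \<open>f x > 0\<close> by (rule order_tendstoD)
qed

text \<open>Near the origin the cubic form with coefficients evaluated at \<open>x\<close> is
  \<open>K(x) y\<^sup>3 + D(x) y z\<^sup>2\<close> in linear coordinates \<open>y, z\<close> that depend smoothly on \<open>x\<close>. The factors
  \<open>K\<close> and \<open>D\<close> do not vanish, so the smooth functions \<open>\<alpha>\<close> and \<open>\<beta>\<close> absorb them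
  up to a sign.\<close>

lemma D4_singularity_of_cubic:
  fixes P Q R :: "real \<times> real \<Rightarrow> real"
  assumes "open W" "0 \<in> W" and PQR: "smooth_on W P" "smooth_on W Q" "smooth_on W R"
    and P0: "P 0 \<noteq> 0" and disc: "4 * Q 0 ^ 3 + 27 * P 0 * (R 0)\<^sup>2 \<noteq> 0"
    and g: "\<And>x. x \<in> W \<Longrightarrow> g x = P x * fst x ^ 3 + Q x * fst x * (snd x)\<^sup>2 + R x * snd x ^ 3"
  shows "D4_singularity_at_0 g"
proof -
  define W1 where "W1 = W \<inter> P -` (- {0})"
  have W1: "open W1" "0 \<in> W1"
    using continuous_open_preimage[OF smooth_on_imp_continuous_on[OF PQR(1)] \<open>open W\<close>, of "- {0}"]
      assms by (auto simp: W1_def)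
  \<comment> \<open>Dividing by \<open>P\<close> gives a monic cubic, which \<open>smooth_simple_root\<close> can treat.\<close>
  define p where "p x = Q x / P x" for x
  define q where "q x = R x / P x" for x
  have sub1: "W1 \<subseteq> W" by (auto simp: W1_def)
  have pq: "smooth_on W1 p" "smooth_on W1 q"
    unfolding p_def q_def
    by (intro smooth_on_divide smooth_on_subset[OF _ sub1] PQR W1; simp add: W1_def)+
  have disc': "4 * p 0 ^ 3 + 27 * (q 0)\<^sup>2 \<noteq> 0"
  proof -
    have "4 * p 0 ^ 3 + 27 * (q 0)\<^sup>2 = (4 * Q 0 ^ 3 + 27 * P 0 * (R 0)\<^sup>2) / P 0 ^ 3"
      using P0 by (simp add: p_def q_def field_simps power2_eq_square power3_eq_cube)
    then show ?thesis using disc P0 by simp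
  qed
  obtain s0 where s0: "s0 ^ 3 + p 0 * s0 + q 0 = 0"
    by (rule depressed_cubic_real_root)
  obtain W2 s where W2: "open W2" "0 \<in> W2" "W2 \<subseteq> W1" and s: "smooth_on W2 s" "s 0 = s0"
    and root: "\<And>x. x \<in> W2 \<Longrightarrow> s x ^ 3 + p x * s x + q x = 0"
    by (rule smooth_simple_root[OF W1 pq s0 cubic_root_multiplicity(1)[OF s0 disc']])
      blast
  define d where "d x = 3 * (s x)\<^sup>2 + p x" for x
  define K where "K x = P x * (3 * (s x)\<^sup>2 + 4 * p x) / (4 * d x)" for x
  define D where "D x = P x * d x" for x
  have d0: "d 0 \<noteq> 0" and K0: "K 0 \<noteq> 0" and D0: "D 0 \<noteq> 0"
    using cubic_root_multiplicity[OF s0 disc'] P0 by (simp_all add: d_def K_def D_def s)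
  define \<sigma> where "\<sigma> = sgn (K 0)"
  define \<tau> where "\<tau> = sgn (D 0)"
  have \<sigma>: "\<sigma>\<^sup>2 = 1" and \<tau>: "\<tau>\<^sup>2 = 1"
    using K0 D0 by (simp_all add: \<sigma>_def \<tau>_def sgn_if)
  have sm_d: "smooth_on W2 d"
    unfolding d_def by (intro smooth_on_add smooth_on_mult smooth_on_const smooth_on_power W2 s
        smooth_on_subset[OF pq(1)])
  define W3 where "W3 = W2 \<inter> d -` (- {0})"
  have W3: "open W3" "0 \<in> W3" and sub3: "W3 \<subseteq> W2" "W3 \<subseteq> W1" "W3 \<subseteq> W"
    using continuous_open_preimage[OF smooth_on_imp_continuous_on[OF sm_d] W2(1), of "- {0}"]
      W2 d0 sub1 by (auto simp: W3_def)
  have sm3: "smooth_on W3 P" "smooth_on W3 p" "smooth_on W3 s" "smooth_on W3 d"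
    using smooth_on_subset sub3 PQR(1) pq(1) s(1) sm_d by blast+
  have smD: "smooth_on W3 D" and smK: "smooth_on W3 K"
    unfolding D_def K_def
    by (intro smooth_on_divide smooth_on_add smooth_on_mult smooth_on_const smooth_on_power W3 sm3;
        simp add: W3_def)+
  have pos0: "\<sigma> * K 0 > 0" "\<tau> * D 0 > 0"
    using K0 D0 by (simp_all add: \<sigma>_def \<tau>_def sgn_if zero_less_mult_iff)
  have "\<forall>\<^sub>F x in nhds 0. x \<in> W3 \<and> \<sigma> * K x > 0 \<and> \<tau> * D x > 0"
    using W3 pos0
    by (intro eventually_conj eventually_nhds_in_open eventually_nhds_pos[where W = W3]
        smooth_on_imp_continuous_on smooth_on_mult smooth_on_const smK smD)
  then obtain W4 where W4: "open W4" "0 \<in> W4" "\<And>x. x \<in> W4 \<Longrightarrow> x \<in> W3"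
    and pos: "\<And>x. x \<in> W4 \<Longrightarrow> \<sigma> * K x > 0" "\<And>x. x \<in> W4 \<Longrightarrow> \<tau> * D x > 0"
    unfolding eventually_nhds by auto
  have sub4: "W4 \<subseteq> W3" using W4 by auto
  have sm4: "smooth_on W4 K" "smooth_on W4 D" "smooth_on W4 s" "smooth_on W4 d"
    using smooth_on_subset[OF _ sub4] smK smD sm3 by blast+
  \<comment> \<open>Real powers need a positive base, so the signs of \<open>K\<close> and \<open>D\<close> are split off.\<close>
  define \<alpha> where "\<alpha> x = \<sigma> * (\<sigma> * K x) powr (1 / 3)" for x
  define \<beta> where "\<beta> x = (\<tau> * D x * (\<sigma> * K x) powr (- (1 / 3))) powr (1 / 2)" for x
  have \<alpha>3: "\<alpha> x ^ 3 = K x" and \<beta>2: "\<sigma> * \<tau> * (\<alpha> x * (\<beta> x)\<^sup>2) = D x" and nz: "\<alpha> x \<noteq> 0" "\<beta> x \<noteq> 0"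
    if "x \<in> W4" for x
  proof -
    have \<sigma>\<sigma>: "\<sigma> * \<sigma> = 1" "\<tau> * \<tau> = 1" using \<sigma> \<tau> by (simp_all add: power2_eq_square)
    have "((\<sigma> * K x) powr (1 / 3)) ^ 3 = \<sigma> * K x"
      using pos[OF that] by (subst powr_power) auto
    then have "\<alpha> x ^ 3 = (\<sigma> * \<sigma>) * (\<sigma> * \<sigma>) * K x"
      by (simp add: \<alpha>_def power3_eq_cube mult_ac)
    then show "\<alpha> x ^ 3 = K x" by (simp add: \<sigma>\<sigma>)
    have "(\<beta> x)\<^sup>2 = \<tau> * D x * (\<sigma> * K x) powr (- (1 / 3))"
      unfolding \<beta>_def using pos[OF that] by (subst powr_power) auto
    then have "\<sigma> * \<tau> * (\<alpha> x * (\<beta> x)\<^sup>2) = (\<sigma> * \<sigma>) * (\<tau> * \<tau>) * D x *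
        ((\<sigma> * K x) powr (1 / 3) * (\<sigma> * K x) powr (- (1 / 3)))"
      unfolding \<alpha>_def by (simp add: mult_ac)
    also have "(\<sigma> * K x) powr (1 / 3) * (\<sigma> * K x) powr (- (1 / 3)) = 1"
      using pos[OF that] unfolding powr_add[symmetric] by auto
    finally show "\<sigma> * \<tau> * (\<alpha> x * (\<beta> x)\<^sup>2) = D x" by (simp add: \<sigma>\<sigma>)
    show "\<alpha> x \<noteq> 0" using pos[OF that] \<sigma> by (auto simp: \<alpha>_def)
    show "\<beta> x \<noteq> 0" using pos[OF that] by (auto simp: \<beta>_def)
  qed
  have sm\<alpha>: "smooth_on W4 \<alpha>"
    unfolding \<alpha>_def by (intro smooth_on_mult smooth_on_const smooth_on_powr sm4 W4 pos)
  have "0 < \<tau> * D x * (\<sigma> * K x) powr (- (1 / 3))" if "x \<in> W4" for x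
    by (rule mult_pos_pos[OF pos(2)[OF that]]) (use pos(1)[OF that] in auto)
  then have sm\<beta>: "smooth_on W4 \<beta>"
    unfolding \<beta>_def by (intro smooth_on_powr smooth_on_mult smooth_on_const sm4 W4 pos)
  define m where "m x = 3 * s x / (2 * d x)" for x
  define y where "y x = fst x - s x * snd x" for x
  define z where "z x = snd x + m x * y x" for x
  define \<phi> where "\<phi> x = (\<alpha> x * y x, \<beta> x * z x)" for x
  have smm: "smooth_on W4 m"
    unfolding m_def using sub4
    by (intro smooth_on_divide smooth_on_mult smooth_on_const W4 sm4) (auto simp: W3_def)
  have smy: "smooth_on W4 y"
    unfolding y_def
    by (intro smooth_on_diff smooth_on_mult smooth_on_fst smooth_on_snd smooth_on_id sm4 W4)
  have smz: "smooth_on W4 z"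
    unfolding z_def by (intro smooth_on_add smooth_on_mult smooth_on_snd smooth_on_id smy smm W4)
  have sm\<phi>: "smooth_on W4 \<phi>"
    unfolding \<phi>_def by (intro smooth_on_Pair smooth_on_mult sm\<alpha> sm\<beta> smy smz W4)
  have dery: "(y has_derivative (\<lambda>t. fst t - s 0 * snd t)) (at 0)"
    unfolding y_def
    by (intro has_derivative_diff has_derivative_mult_at_zero[OF smooth_on_has_derivative[OF sm4(3) W4(2)]]
       has_derivative_fst has_derivative_snd has_derivative_ident) simp
  have derz: "(z has_derivative (\<lambda>t. snd t + m 0 * (fst t - s 0 * snd t))) (at 0)"
    unfolding z_def
    by (intro has_derivative_add has_derivative_mult_at_zero[OF smooth_on_has_derivative[OF smm W4(2)]] dery
       has_derivative_snd has_derivative_ident) (simp add: y_def)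
  have der\<phi>: "(\<phi> has_derivative (\<lambda>t. (\<alpha> 0 * (fst t - s 0 * snd t),
      \<beta> 0 * (snd t + m 0 * (fst t - s 0 * snd t))))) (at 0)"
    unfolding \<phi>_def
    by (intro has_derivative_Pair has_derivative_mult_at_zero[OF smooth_on_has_derivative[OF sm\<alpha> W4(2)]]
       has_derivative_mult_at_zero[OF smooth_on_has_derivative[OF sm\<beta> W4(2)]] dery derz)
      (simp_all add: y_def z_def)
  have "jacobian \<phi> 0 = \<alpha> 0 * \<beta> 0"
    unfolding jacobian_def du_def dv_def frechet_derivative_at[OF der\<phi>, symmetric]
    by (simp add: algebra_simps)
  then have "jacobian \<phi> 0 \<noteq> 0" using nz[OF W4(2)] by simp
  then obtain U V \<phi>' where "open U" "U \<subseteq> W4" "0 \<in> U" "open V" "\<phi> 0 \<in> V"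
    "homeomorphism U V \<phi> \<phi>'" "smooth_on V \<phi>'"
    by (rule plane_inverse_function_theorem[OF W4(1,2) sm\<phi>])
  moreover have "\<phi> 0 = 0" by (simp add: \<phi>_def y_def z_def zero_prod_def)
  ultimately have diffeo: "diffeo_germ \<phi> 0 0"
    unfolding diffeo_germ_def using smooth_on_subset[OF sm\<phi>] by blast
  have "g x = D4_form (\<sigma> * \<tau>) (\<phi> x)" if x: "x \<in> W4" for x
  proof -
    have in_W: "x \<in> W" "x \<in> W2" "P x \<noteq> 0" "d x \<noteq> 0"
      using x sub4 sub3 by (auto simp: W3_def W1_def)
    have "g x = P x * (fst x ^ 3 + p x * fst x * (snd x)\<^sup>2 + q x * snd x ^ 3)"
      using in_W(3) by (simp add: g[OF in_W(1)] p_def q_def algebra_simps)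
    also have "\<dots> = K x * y x ^ 3 + D x * y x * (z x)\<^sup>2"
      unfolding K_def D_def d_def z_def m_def y_def
      by (intro cubic_as_cube_plus_square root[OF in_W(2)] in_W(4)[unfolded d_def])
    also have "\<dots> = (\<alpha> x * y x) ^ 3 + \<sigma> * \<tau> * (\<alpha> x * y x * (\<beta> x * z x)\<^sup>2)"
      unfolding \<alpha>3[OF x, symmetric] \<beta>2[OF x, symmetric] by (simp add: power_mult_distrib)
    finally show ?thesis by (simp add: \<phi>_def)
  qed
  then have "right_equivalent_at_0 g (D4_form (\<sigma> * \<tau>))"
    unfolding right_equivalent_at_0_def eventually_nhds using diffeo W4 by blast
  moreover have "(\<sigma> * \<tau>)\<^sup>2 = 1" by (simp add: power_mult_distrib \<sigma> \<tau>)
  ultimately show ?thesis unfolding D4_singularity_iff by (intro exI[of _ "\<sigma> * \<tau>"] conjI)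
qed

section \<open>Singularities of type \<open>D\<^sub>4\<close> have a nondegenerate cubic part\<close>

text \<open>The chain rule for \<open>\<phi>' \<circ> \<phi> = id\<close> gives a left inverse of the derivative.\<close>

lemma diffeo_germ_derivative:
  fixes \<phi> :: "'a::euclidean_space \<Rightarrow> 'a"
  assumes "diffeo_germ \<phi> p q"
  obtains A where "(\<phi> has_derivative A) (at p)" "inj A" "surj A"
proof -
  obtain U V \<phi>' where U: "open U" "p \<in> U" "\<phi> p = q" and V: "open V"
    and hom: "homeomorphism U V \<phi> \<phi>'" and sm: "smooth_on U \<phi>" "smooth_on V \<phi>'"
    using assms unfolding diffeo_germ_def by blast
  define A where "A = frechet_derivative \<phi> (at p)"
  define B where "B = frechet_derivative \<phi>' (at (\<phi> p))"
  have pV: "\<phi> p \<in> V" using hom U(2) by (auto simp: homeomorphism_def)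
  have A: "(\<phi> has_derivative A) (at p)"
    unfolding A_def by (rule smooth_on_has_derivative[OF sm(1) U(2)])
  have "(\<phi>' has_derivative B) (at (\<phi> p))"
    unfolding B_def by (rule smooth_on_has_derivative[OF sm(2) pV])
  from has_derivative_compose[OF A this]
  have "((\<lambda>x. \<phi>' (\<phi> x)) has_derivative (\<lambda>t. B (A t))) (at p)" .
  then have "((\<lambda>x. x) has_derivative (\<lambda>t. B (A t))) (at p)"
    by (rule has_derivative_transform_within_open[OF _ U(1,2)])
      (use homeomorphism_apply1[OF hom] in auto)
  then have "(\<lambda>t. B (A t)) = (\<lambda>t. t)"
    using has_derivative_ident has_derivative_unique by blast
  then have "inj A" by (metis injI)
  moreover have "linear A" using has_derivative_linear[OF A] .
  ultimately show ?thesis using that[OF A] linear_injective_imp_surjective by blast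
qed

lemma directional_quotient_tendsto:
  fixes \<phi> :: "'a::real_normed_vector \<Rightarrow> real"
  assumes "(\<phi> has_derivative A) (at 0)" "\<phi> 0 = 0"
  shows "((\<lambda>t. \<phi> (t *\<^sub>R w) / t) \<longlongrightarrow> A w) (at (0::real))"
proof -
  have lin: "linear A" using has_derivative_linear[OF assms(1)] .
  have "((\<lambda>t::real. t *\<^sub>R w) has_derivative (\<lambda>t. t *\<^sub>R w)) (at 0)"
    by (intro derivative_intros)
  then have "((\<lambda>t. \<phi> (t *\<^sub>R w)) has_derivative (\<lambda>t. A (t *\<^sub>R w))) (at 0)"
    by (rule has_derivative_compose) (use assms in simp)
  moreover have "(\<lambda>t. A (t *\<^sub>R w)) = (*) (A w)"
    by (auto simp: linear_cmul[OF lin])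
  ultimately have "((\<lambda>t. \<phi> (t *\<^sub>R w)) has_field_derivative A w) (at 0)"
    by (simp add: has_field_derivative_def)
  then show ?thesis
    unfolding DERIV_def using assms(2) by simp
qed

lemma D4_form_cubic: "D4_form \<epsilon> (t *\<^sub>R w) = t ^ 3 * D4_form \<epsilon> w"
  by (cases w) (simp add: power_mult_distrib power2_eq_square power3_eq_cube algebra_simps)

text \<open>A real binary cubic form of discriminant zero has a repeated linear factor, along which its
  differential vanishes.\<close>

lemma binary_cubic_critical_vector:
  fixes P Q R :: real
  assumes "4 * Q ^ 3 + 27 * P * R\<^sup>2 = 0 \<or> P = 0" "R \<noteq> 0"
  obtains w where "w \<noteq> 0" "3 * P * (fst w)\<^sup>2 + Q * (snd w)\<^sup>2 = 0"
    "2 * Q * fst w * snd w + 3 * R * (snd w)\<^sup>2 = 0"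
proof (cases "P = 0")
  case True
  then show ?thesis using that[of "(1, 0)"] by (simp add: zero_prod_def)
next
  case False
  then have "4 * Q ^ 3 + 27 * P * R\<^sup>2 = 0" using assms by auto
  then show ?thesis using that[of "(3 * R, - 2 * Q)"] assms(2)
    by (simp add: zero_prod_def power2_eq_square power3_eq_cube algebra_simps)
qed

text \<open>The differential is grouped by the two partial derivatives, in the form in which
  \<open>binary_cubic_critical_vector\<close> makes them vanish.\<close>

lemma cubic_form_has_derivative:
  fixes P Q R :: real
  shows "((\<lambda>w. P * fst w ^ 3 + Q * fst w * (snd w)\<^sup>2 + R * snd w ^ 3) has_derivative
    (\<lambda>t. (3 * P * (fst w)\<^sup>2 + Q * (snd w)\<^sup>2) * fst t
       + (2 * Q * fst w * snd w + 3 * R * (snd w)\<^sup>2) * snd t)) (at w)"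
  by (rule derivative_eq_intros refl)+ (simp add: fun_eq_iff algebra_simps power2_eq_square)

text \<open>Along the line through \<open>w\<close>, the right-hand side of \<open>g = k \<circ> \<phi>\<close> is \<open>t\<^sup>3 k(A w) + o(t\<^sup>3)\<close>, where
  \<open>A\<close> is the derivative of \<open>\<phi>\<close> at the origin, and the left-hand side is
  \<open>b w\<^sub>1\<^sup>2 t\<^sup>2 + t\<^sup>3 C(w) + o(t\<^sup>3)\<close>. So \<open>b = 0\<close> and \<open>C = k \<circ> A\<close>. As \<open>A\<close> is bijective, a
  nonzero critical point of \<open>C\<close> would give one of \<open>k\<close>.\<close>

lemma D4_singularity_imp_cubic:
  fixes P Q R :: "real \<times> real \<Rightarrow> real"
  assumes D4: "D4_singularity_at_0 g"
    and cont: "isCont P 0" "isCont Q 0" "isCont R 0"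
    and g: "\<forall>\<^sub>F x in nhds 0.
      g x = b * (fst x)\<^sup>2 + P x * fst x ^ 3 + Q x * fst x * (snd x)\<^sup>2 + R x * snd x ^ 3"
    and R0: "R 0 \<noteq> 0"
  shows "b = 0" and "P 0 \<noteq> 0" and "4 * Q 0 ^ 3 + 27 * P 0 * (R 0)\<^sup>2 \<noteq> 0"
proof -
  obtain \<epsilon> \<phi> where \<epsilon>: "\<epsilon>\<^sup>2 = 1" and diffeo: "diffeo_germ \<phi> 0 0"
    and eq: "\<forall>\<^sub>F x in nhds 0. g x = D4_form \<epsilon> (\<phi> x)"
    using D4 unfolding D4_singularity_iff right_equivalent_at_0_def by blast
  have \<phi>0: "\<phi> 0 = 0" using diffeo unfolding diffeo_germ_def by blast
  obtain A where A: "(\<phi> has_derivative A) (at 0)" "inj A" "surj A"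
    using diffeo by (rule diffeo_germ_derivative)
  have linA: "linear A" using has_derivative_linear[OF A(1)] .
  define C where "C x w = P x * fst w ^ 3 + Q x * fst w * (snd w)\<^sup>2 + R x * snd w ^ 3"
    for x w :: "real \<times> real"
  have line: "((\<lambda>t. t *\<^sub>R w) \<longlongrightarrow> 0) (at (0::real))" for w :: "real \<times> real"
    by (intro tendsto_eq_intros) auto
  have limC: "((\<lambda>t. C (t *\<^sub>R w) w) \<longlongrightarrow> C 0 w) (at (0::real))" for w
    unfolding C_def by (intro tendsto_intros isCont_tendsto_compose[OF _ line] cont)
  have limk: "((\<lambda>t. D4_form \<epsilon> (fst (\<phi> (t *\<^sub>R w)) / t, snd (\<phi> (t *\<^sub>R w)) / t)) \<longlongrightarrow> D4_form \<epsilon> (A w))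
      (at (0::real))" for w
  proof -
    have "((\<lambda>t. fst (\<phi> (t *\<^sub>R w)) / t) \<longlongrightarrow> fst (A w)) (at (0::real))"
      "((\<lambda>t. snd (\<phi> (t *\<^sub>R w)) / t) \<longlongrightarrow> snd (A w)) (at (0::real))"
      by (rule directional_quotient_tendsto;
          simp add: \<phi>0 has_derivative_fst[OF A(1)] has_derivative_snd[OF A(1)])+
    then show ?thesis
      unfolding case_prod_beta fst_conv snd_conv by (intro tendsto_intros)
  qed
  \<comment> \<open>The identity \<open>g = k \<circ> \<phi>\<close> along a line, divided by \<open>t\<^sup>2\<close>: one power of \<open>t\<close> is left on both cubic terms,
    so that the limit detects \<open>b\<close>.\<close>
  have ev: "\<forall>\<^sub>F t in at (0::real). b * (fst w)\<^sup>2 + t * C (t *\<^sub>R w) w =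
      t * D4_form \<epsilon> (fst (\<phi> (t *\<^sub>R w)) / t, snd (\<phi> (t *\<^sub>R w)) / t)" for w
  proof -
    have "\<forall>\<^sub>F t in at (0::real). b * (fst (t *\<^sub>R w))\<^sup>2 + C (t *\<^sub>R w) (t *\<^sub>R w) = D4_form \<epsilon> (\<phi> (t *\<^sub>R w))"
      using eventually_compose_filterlim[OF eventually_conj[OF g eq] line[of w]]
      by eventually_elim (simp add: C_def)
    moreover have "\<forall>\<^sub>F t in at (0::real). t \<noteq> 0" by (simp add: eventually_at_filter)
    ultimately show ?thesis
    proof eventually_elim
      case (elim t)
      have "D4_form \<epsilon> (\<phi> (t *\<^sub>R w)) =
          D4_form \<epsilon> (t *\<^sub>R (fst (\<phi> (t *\<^sub>R w)) / t, snd (\<phi> (t *\<^sub>R w)) / t))"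
        using elim by simp
      also have "\<dots> = t\<^sup>2 * (t * D4_form \<epsilon> (fst (\<phi> (t *\<^sub>R w)) / t, snd (\<phi> (t *\<^sub>R w)) / t))"
        unfolding D4_form_cubic by (simp add: power2_eq_square power3_eq_cube)
      moreover have "b * (fst (t *\<^sub>R w))\<^sup>2 + C (t *\<^sub>R w) (t *\<^sub>R w)
          = t\<^sup>2 * (b * (fst w)\<^sup>2 + t * C (t *\<^sub>R w) w)"
        by (simp add: C_def power_mult_distrib power2_eq_square power3_eq_cube algebra_simps)
      ultimately show ?case using elim by simp
    qed
  qed
  have t0: "((\<lambda>t::real. t) \<longlongrightarrow> 0) (at 0)" by (rule tendsto_ident_at)
  have "b * (fst w)\<^sup>2 + 0 * C 0 w = 0 * D4_form \<epsilon> (A w)" for w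
    by (rule tendsto_unique[OF _ tendsto_cong[OF ev[of w], THEN iffD1]])
      (intro tendsto_add tendsto_mult tendsto_const t0 limC limk at_neq_bot)+
  from this[of "(1, 0)"] show b: "b = 0" by simp
  have Ck: "C 0 w = D4_form \<epsilon> (A w)" for w
  proof (rule tendsto_unique[OF at_neq_bot _ limk])
    have "\<forall>\<^sub>F t in at (0::real). t \<noteq> 0" by (simp add: eventually_at_filter)
    with ev[of w] have "\<forall>\<^sub>F t in at (0::real). C (t *\<^sub>R w) w =
        D4_form \<epsilon> (fst (\<phi> (t *\<^sub>R w)) / t, snd (\<phi> (t *\<^sub>R w)) / t)"
      by eventually_elim (simp add: b)
    from tendsto_cong[OF this, THEN iffD1, OF limC]
    show "((\<lambda>t. D4_form \<epsilon> (fst (\<phi> (t *\<^sub>R w)) / t, snd (\<phi> (t *\<^sub>R w)) / t)) \<longlongrightarrow> C 0 w) (at 0)" .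
  qed
  have "\<not> (4 * Q 0 ^ 3 + 27 * P 0 * (R 0)\<^sup>2 = 0 \<or> P 0 = 0)"
  proof
    assume "4 * Q 0 ^ 3 + 27 * P 0 * (R 0)\<^sup>2 = 0 \<or> P 0 = 0"
    then obtain w where w: "w \<noteq> 0" "3 * P 0 * (fst w)\<^sup>2 + Q 0 * (snd w)\<^sup>2 = 0"
      "2 * Q 0 * fst w * snd w + 3 * R 0 * (snd w)\<^sup>2 = 0"
      using binary_cubic_critical_vector[OF _ R0] by metis
    have C0: "(C 0 has_derivative (\<lambda>t. 0)) (at w)"
      using cubic_form_has_derivative[of "P 0" "Q 0" "R 0" w] w by (simp add: C_def[abs_def])
    define x where "x = A w"
    have "D4_form \<epsilon> = (\<lambda>w. 1 * fst w ^ 3 + \<epsilon> * fst w * (snd w)\<^sup>2 + 0 * snd w ^ 3)"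
      by (auto simp: case_prod_beta)
    then have k: "(D4_form \<epsilon> has_derivative (\<lambda>t. (3 * (fst x)\<^sup>2 + \<epsilon> * (snd x)\<^sup>2) * fst t
       + (2 * \<epsilon> * fst x * snd x) * snd t)) (at (A w))"
      using cubic_form_has_derivative[of 1 \<epsilon> 0 x] by (simp add: x_def)
    have "(A has_derivative A) (at w)"
      using linear_imp_has_derivative[OF linA] .
    from has_derivative_compose[OF this k]
    have "((\<lambda>w. D4_form \<epsilon> (A w)) has_derivative (\<lambda>t. (3 * (fst x)\<^sup>2 + \<epsilon> * (snd x)\<^sup>2) * fst (A t)
       + (2 * \<epsilon> * fst x * snd x) * snd (A t))) (at w)" .
    then have "(C 0 has_derivative (\<lambda>t. (3 * (fst x)\<^sup>2 + \<epsilon> * (snd x)\<^sup>2) * fst (A t)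
       + (2 * \<epsilon> * fst x * snd x) * snd (A t))) (at w)"
      unfolding Ck[symmetric] .
    then have "(\<lambda>t. (3 * (fst x)\<^sup>2 + \<epsilon> * (snd x)\<^sup>2) * fst (A t)
       + (2 * \<epsilon> * fst x * snd x) * snd (A t)) = (\<lambda>t. 0)"
      by (rule has_derivative_unique[OF _ C0])
    note crit_A = fun_cong[OF this]
    have crit: "(3 * (fst x)\<^sup>2 + \<epsilon> * (snd x)\<^sup>2) * fst y + (2 * \<epsilon> * fst x * snd x) * snd y = 0" for y
    proof -
      obtain t where "y = A t" using A(3) by (rule surjE)
      then show ?thesis using crit_A[of t] by simp
    qed
    have "\<epsilon> \<noteq> 0" using \<epsilon> by auto
    with crit[of "(1, 0)"] crit[of "(0, 1)"] have "fst x = 0 \<and> snd x = 0" by auto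
    then have "A w = 0" by (simp add: x_def prod_eq_iff)
    then show False using A(2) linear_injective_0[OF linA] w(1) by blast
  qed
  then show "P 0 \<noteq> 0" "4 * Q 0 ^ 3 + 27 * P 0 * (R 0)\<^sup>2 \<noteq> 0" by auto
qed

section \<open>Principal curvature of a front along its singular axis\<close>

lemma du_dv_eq:
  assumes "(g has_derivative D) (at p)"
  shows "du g p = D (1, 0)" "dv g p = D (0, 1)"
  unfolding du_def dv_def frechet_derivative_at[OF assms, symmetric] by simp_all

lemma du_dv_cong:
  assumes "open S" "p \<in> S" "\<And>q. q \<in> S \<Longrightarrow> g q = k q" "smooth_on S k"
  shows "du g p = du k p" "dv g p = dv k p"
proof -
  have "(g has_derivative frechet_derivative k (at p)) (at p)"
    by (rule has_derivative_transform_within_open[OF smooth_on_has_derivative[OF assms(4,2)] assms(1,2)])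
      (simp add: assms(3))
  from du_dv_eq[OF this] show "du g p = du k p" "dv g p = dv k p"
    by (simp_all add: du_def dv_def)
qed

lemma du_dv_inner:
  assumes "smooth_on S a" "smooth_on S b" "p \<in> S"
  shows "du (\<lambda>q. a q \<bullet> b q) p = du a p \<bullet> b p + a p \<bullet> du b p"
    and "dv (\<lambda>q. a q \<bullet> b q) p = dv a p \<bullet> b p + a p \<bullet> dv b p"
  using du_dv_eq[OF has_derivative_inner[OF smooth_on_has_derivative[OF assms(1,3)]
        smooth_on_has_derivative[OF assms(2,3)]]]
  by (simp_all add: du_def dv_def)

text \<open>Every point of the axis is a limit of points off the axis, so the limit that defines the extension
  is the value of any continuous function that agrees with \<open>g\<close> off the axis.\<close>

lemma extend_axis_eq:
  assumes "open S" "p \<in> S" "continuous_on S k" "\<And>q. q \<in> S \<Longrightarrow> snd q \<noteq> 0 \<Longrightarrow> g q = k q"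
  shows "extend_axis g p = k p"
proof (cases "snd p = 0")
  case True
  let ?F = "at p within {q. snd q \<noteq> 0}"
  have "?F \<noteq> bot"
  proof -
    have "p islimpt {q. snd q \<noteq> 0}"
      unfolding islimpt_approachable
    proof (intro allI impI)
      fix e :: real
      assume "e > 0"
      then show "\<exists>x'\<in>{q. snd q \<noteq> 0}. x' \<noteq> p \<and> dist x' p < e"
        using True by (intro bexI[of _ "(fst p, e / 2)"]) (auto simp: dist_prod_def prod_eq_iff)
    qed
    then show ?thesis by (simp add: trivial_limit_within)
  qed
  moreover have "(g \<longlongrightarrow> k p) ?F"
  proof (rule tendsto_cong[THEN iffD1])
    show "(k \<longlongrightarrow> k p) ?F"
      using assms(2,3) continuous_on_eq_continuous_at[OF assms(1), of k]
      by (auto intro: tendsto_within_subset simp: isCont_def)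
    have "\<forall>\<^sub>F q in ?F. q \<in> S"
      using assms(1,2) by (auto simp: eventually_at_topological)
    then show "\<forall>\<^sub>F q in ?F. k q = g q"
      unfolding eventually_at_filter by eventually_elim (simp add: assms(4))
  qed
  ultimately have "Lim ?F g = k p" by (rule tendsto_Lim)
  then show ?thesis using True by (simp add: extend_axis_def)
qed (use assms in \<open>simp add: extend_axis_def\<close>)

text \<open>The formulas for \<open>\<kappa>\<close> rest on \<open>f\<^sub>v = v \<psi>\<close> and the linear independence of
  \<open>f\<^sub>u\<close> and \<open>\<psi>\<close> alone. A normal form enters only through values at the origin.\<close>

locale axis_singular_front =
  fixes f \<psi> :: "real \<times> real \<Rightarrow> real ^ 3" and W
  assumes open_W: "open W"
    and smooth_f: "smooth_on W f" and smooth_\<psi>: "smooth_on W \<psi>"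
    and dv_f: "\<And>p. p \<in> W \<Longrightarrow> dv f p = snd p *\<^sub>R \<psi> p"
    and immersive: "\<And>p. p \<in> W \<Longrightarrow> cross3 (du f p) (\<psi> p) \<noteq> 0"
begin

lemma psi_eq: "p \<in> W \<Longrightarrow> psi f p = \<psi> p"
  unfolding psi_def
  by (rule extend_axis_eq[OF open_W _ smooth_on_imp_continuous_on[OF smooth_\<psi>]]) (auto simp: dv_f)

lemma smooth_psi: "smooth_on W (psi f)"
  by (rule smooth_on_cong[OF open_W smooth_\<psi>]) (simp add: psi_eq)

lemma smooth_nu: "smooth_on W (nu f)"
proof -
  have "smooth_on W (\<lambda>p. cross3 (du f p) (psi f p))"
    by (intro smooth_on_cross3 smooth_on_du smooth_f smooth_psi open_W)
  then have "smooth_on W (\<lambda>p. cross3 (du f p) (psi f p) /\<^sub>R norm (cross3 (du f p) (psi f p)))"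
    by (intro smooth_on_scaleR smooth_on_inverse smooth_on_norm open_W)
      (auto simp: psi_eq immersive)
  then show ?thesis unfolding nu_def[abs_def] .
qed

lemma nu_orthogonal:
  shows "du f p \<bullet> nu f p = 0" and "psi f p \<bullet> nu f p = 0"
  unfolding nu_def by (simp_all add: dot_cross_self)

text \<open>Differentiating the orthogonality relations moves the derivative from \<open>\<nu>\<close> to \<open>f\<^sub>u\<close> and
  \<open>\<psi>\<close>, whose derivatives are explicit in the normal form.\<close>

lemma fundamental_coefficients:
  assumes "p \<in> W"
  shows "L_hat f p = du (du f) p \<bullet> nu f p"
    and "M_hat f p = du (psi f) p \<bullet> nu f p"
    and "N_hat f p = dv (psi f) p \<bullet> nu f p"
proof -
  have zero: "du (\<lambda>q::real \<times> real. 0 :: real) p = 0" "dv (\<lambda>q::real \<times> real. 0 :: real) p = 0"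
    by (rule du_dv_eq[OF has_derivative_const])+
  show "L_hat f p = du (du f) p \<bullet> nu f p"
    using du_dv_inner(1)[OF smooth_on_du[OF smooth_f] smooth_nu assms]
    unfolding nu_orthogonal zero L_hat_def by linarith
  show "M_hat f p = du (psi f) p \<bullet> nu f p"
    using du_dv_inner(1)[OF smooth_psi smooth_nu assms]
    unfolding nu_orthogonal zero M_hat_def by linarith
  show "N_hat f p = dv (psi f) p \<bullet> nu f p"
    using du_dv_inner(2)[OF smooth_psi smooth_nu assms]
    unfolding nu_orthogonal zero N_hat_def by linarith
qed

lemma smooth_coefficients:
  shows "smooth_on W (E_hat f)" "smooth_on W (F_hat f)" "smooth_on W (G_hat f)"
    and "smooth_on W (L_hat f)" "smooth_on W (M_hat f)" "smooth_on W (N_hat f)"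
  unfolding E_hat_def[abs_def] F_hat_def[abs_def] G_hat_def[abs_def]
    L_hat_def[abs_def] M_hat_def[abs_def] N_hat_def[abs_def]
  by (intro smooth_on_minus smooth_on_inner smooth_on_du smooth_on_dv smooth_f smooth_psi smooth_nu
      open_W)+

lemma smooth_A: "smooth_on W (A_hat f)"
  unfolding A_hat_def[abs_def]
  by (intro smooth_on_add smooth_on_diff smooth_on_mult smooth_on_snd smooth_on_id smooth_on_const
      smooth_coefficients open_W)

lemma gram_pos:
  assumes "p \<in> W"
  shows "E_hat f p * G_hat f p - (F_hat f p)\<^sup>2 > 0"
proof -
  have "E_hat f p * G_hat f p - (F_hat f p)\<^sup>2 = (norm (cross3 (du f p) (psi f p)))\<^sup>2"
    using norm_cross_dot[of "du f p" "psi f p"]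
    by (simp add: E_hat_def F_hat_def G_hat_def power_mult_distrib power2_norm_eq_inner)
  then show ?thesis using immersive[OF assms] by (simp add: psi_eq[OF assms])
qed

text \<open>Since \<open>A\<^sup>2 - B\<^sup>2\<close> has the factor \<open>v\<close>, rationalising the numerator \<open>A - B\<close> cancels the \<open>v\<close> in the
  denominator of \<open>kappa2_hat\<close>. The quotient that remains is smooth across the axis.\<close>

lemma kappa2_rationalised:
  assumes "0 \<in> W" "A_hat f 0 > 0"
  obtains S where "open S" "0 \<in> S" "S \<subseteq> W" "smooth_on S (\<lambda>p. 2 / (A_hat f p + B_hat f p))"
    "\<And>p. p \<in> S \<Longrightarrow> kappa2_hat f p =
       2 / (A_hat f p + B_hat f p) * (L_hat f p * N_hat f p - snd p * (M_hat f p)\<^sup>2)"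
proof -
  define \<Delta> where "\<Delta> p = (A_hat f p)\<^sup>2 - 4 * snd p * (E_hat f p * G_hat f p - (F_hat f p)\<^sup>2)
     * (L_hat f p * N_hat f p - snd p * (M_hat f p)\<^sup>2)" for p
  have B: "B_hat f = (\<lambda>p. sqrt (\<Delta> p))"
    by (simp add: fun_eq_iff B_hat_def \<Delta>_def)
  have sm\<Delta>: "smooth_on W \<Delta>"
    unfolding \<Delta>_def[abs_def]
    by (intro smooth_on_add smooth_on_diff smooth_on_mult smooth_on_power smooth_on_snd smooth_on_id
        smooth_on_const smooth_coefficients smooth_A open_W)
  have "\<Delta> 0 > 0" using assms(2) by (simp add: \<Delta>_def)
  then have "\<forall>\<^sub>F p in nhds 0. p \<in> W \<and> A_hat f p > 0 \<and> \<Delta> p > 0"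
    by (intro eventually_conj eventually_nhds_in_open eventually_nhds_pos[where W = W]
        smooth_on_imp_continuous_on open_W smooth_A sm\<Delta> assms)
  then obtain S where S: "open S" "0 \<in> S" "\<And>p. p \<in> S \<Longrightarrow> p \<in> W"
    and pos: "\<And>p. p \<in> S \<Longrightarrow> A_hat f p > 0" "\<And>p. p \<in> S \<Longrightarrow> \<Delta> p > 0"
    unfolding eventually_nhds by auto
  have sub: "S \<subseteq> W" using S(3) by auto
  have smB: "smooth_on S (B_hat f)"
    unfolding B by (intro smooth_on_sqrt smooth_on_subset[OF sm\<Delta> sub] S pos)
  have AB: "A_hat f p + B_hat f p > 0" if "p \<in> S" for p
    using pos[OF that] by (simp add: B add_pos_pos)
  have smAB: "smooth_on S (\<lambda>p. 2 / (A_hat f p + B_hat f p))"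
    using AB by (intro smooth_on_divide smooth_on_add smooth_on_const smB smooth_on_subset[OF smooth_A sub] S)
      force
  have "kappa2_hat f p = 2 / (A_hat f p + B_hat f p) * (L_hat f p * N_hat f p - snd p * (M_hat f p)\<^sup>2)"
    if p: "p \<in> S" for p
    unfolding kappa2_hat_def
  proof (rule extend_axis_eq[OF S(1) p])
    show "continuous_on S (\<lambda>p. 2 / (A_hat f p + B_hat f p) *
        (L_hat f p * N_hat f p - snd p * (M_hat f p)\<^sup>2))"
      by (intro smooth_on_imp_continuous_on smooth_on_mult smAB smooth_on_diff smooth_on_power
          smooth_on_snd smooth_on_id smooth_on_subset[OF _ sub] smooth_coefficients S)
  next
    fix q
    assume q: "q \<in> S" "snd q \<noteq> 0"
    define d where "d = E_hat f q * G_hat f q - (F_hat f q)\<^sup>2"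
    define n where "n = L_hat f q * N_hat f q - snd q * (M_hat f q)\<^sup>2"
    have d: "d \<noteq> 0" using gram_pos[of q] S(3)[OF q(1)] by (simp add: d_def)
    have "(B_hat f q)\<^sup>2 = (A_hat f q)\<^sup>2 - 4 * snd q * d * n"
      using pos(2)[OF q(1)] by (simp add: B) (simp add: \<Delta>_def d_def n_def)
    then have "(A_hat f q - B_hat f q) * (A_hat f q + B_hat f q) = 4 * snd q * d * n"
      by (simp add: algebra_simps power2_eq_square)
    then have "(A_hat f q - B_hat f q) / (2 * snd q * d) = 2 / (A_hat f q + B_hat f q) * n"
      using d q(2) AB[OF q(1)] by (simp add: field_simps)
    then show "(A_hat f q - B_hat f q) / (2 * snd q * (E_hat f q * G_hat f q - (F_hat f q)\<^sup>2)) =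
       2 / (A_hat f q + B_hat f q) * (L_hat f q * N_hat f q - snd q * (M_hat f q)\<^sup>2)"
      by (simp add: d_def n_def)
  qed
  with that[OF S(1,2) sub smAB] show ?thesis by blast
qed

lemma A_at_0: "A_hat f 0 = E_hat f 0 * N_hat f 0"
  by (simp add: A_hat_def)

lemma B_at_0: "A_hat f 0 > 0 \<Longrightarrow> B_hat f 0 = A_hat f 0"
  by (simp add: B_hat_def)

lemma kappa2_at_0:
  assumes "0 \<in> W" "A_hat f 0 > 0"
  shows "kappa2_hat f 0 = L_hat f 0 / E_hat f 0"
proof -
  obtain S where "0 \<in> S" "\<And>p. p \<in> S \<Longrightarrow> kappa2_hat f p =
       2 / (A_hat f p + B_hat f p) * (L_hat f p * N_hat f p - snd p * (M_hat f p)\<^sup>2)"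
    by (rule kappa2_rationalised[OF assms]) blast
  then have "kappa2_hat f 0 = L_hat f 0 * N_hat f 0 / A_hat f 0"
    using B_at_0[OF assms(2)] by simp
  then show ?thesis using assms(2) by (auto simp: A_at_0)
qed

text \<open>Here \<open>\<kappa>\<close> is a product whose second factor \<open>L N - v M\<^sup>2\<close> vanishes at the origin, so only the
  derivative of that factor contributes.\<close>

lemma kappa2_derivative_at_0:
  assumes "0 \<in> W" "A_hat f 0 > 0" and L0: "L_hat f 0 = 0"
  shows "frechet_derivative (kappa2_hat f) (at 0) t =
    (N_hat f 0 * (fst t * du (L_hat f) 0 + snd t * dv (L_hat f) 0) - snd t * (M_hat f 0)\<^sup>2) / A_hat f 0"
proof -
  obtain S where S: "open S" "0 \<in> S" "S \<subseteq> W"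
    and smAB: "smooth_on S (\<lambda>p. 2 / (A_hat f p + B_hat f p))"
    and kappa: "\<And>p. p \<in> S \<Longrightarrow> kappa2_hat f p =
       2 / (A_hat f p + B_hat f p) * (L_hat f p * N_hat f p - snd p * (M_hat f p)\<^sup>2)"
    by (rule kappa2_rationalised[OF assms(1,2)]) blast
  define l where "l t = fst t * du (L_hat f) 0 + snd t * dv (L_hat f) 0" for t :: "real \<times> real"
  have L: "(L_hat f has_derivative l) (at 0)"
    using smooth_on_has_derivative_du_dv[OF smooth_coefficients(4) assms(1)] by (simp add: l_def[abs_def])
  have M2: "((\<lambda>p. (M_hat f p)\<^sup>2) has_derivative frechet_derivative (\<lambda>p. (M_hat f p)\<^sup>2) (at 0)) (at 0)"
    by (rule smooth_on_has_derivative[OF smooth_on_power[OF open_W smooth_coefficients(5)] assms(1)])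
  have "((\<lambda>p. N_hat f p * L_hat f p - (M_hat f p)\<^sup>2 * snd p) has_derivative
      (\<lambda>t. N_hat f 0 * l t - (M_hat f 0)\<^sup>2 * snd t)) (at 0)"
    by (intro has_derivative_diff L L0 has_derivative_snd has_derivative_ident
        has_derivative_mult_at_zero[OF smooth_on_has_derivative[OF smooth_coefficients(6) assms(1)]]
        has_derivative_mult_at_zero[OF M2]) simp
  then have "((\<lambda>p. 2 / (A_hat f p + B_hat f p) * (N_hat f p * L_hat f p - (M_hat f p)\<^sup>2 * snd p))
      has_derivative
      (\<lambda>t. 2 / (A_hat f 0 + B_hat f 0) * (N_hat f 0 * l t - (M_hat f 0)\<^sup>2 * snd t))) (at 0)"
    by (intro has_derivative_mult_at_zero[OF smooth_on_has_derivative[OF smAB S(2)]]) (simp_all add: L0)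
  then have "(kappa2_hat f has_derivative
      (\<lambda>t. 2 / (A_hat f 0 + B_hat f 0) * (N_hat f 0 * l t - (M_hat f 0)\<^sup>2 * snd t))) (at 0)"
    by (rule has_derivative_transform_within_open[OF _ S(1,2)]) (simp add: kappa mult.commute)
  from frechet_derivative_at[OF this, symmetric] show ?thesis
    by (simp add: B_at_0[OF assms(2)] l_def mult.commute)
qed

end

section \<open>The normal form of a cuspidal edge\<close>

lemma vector3_axis: "(vector [a, b, c] :: real ^ 3) = a *\<^sub>R axis 1 1 + b *\<^sub>R axis 2 1 + c *\<^sub>R axis 3 1"
  by (simp add: vec_eq_iff forall_3 axis_def)

lemma inner_vector3: "(vector [a, b, c] :: real ^ 3) \<bullet> vector [x, y, z] = a * x + b * y + c * z"
  by (simp add: inner_vec_def sum_3)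

lemma smooth_on_vector3:
  assumes "open S" "smooth_on S a" "smooth_on S b" "smooth_on S c"
  shows "smooth_on S (\<lambda>p. vector [a p, b p, c p] :: real ^ 3)"
  unfolding vector3_axis by (intro smooth_on_add smooth_on_scaleR smooth_on_const assms)

lemma du_dv_vector3:
  assumes "smooth_on S a" "smooth_on S b" "smooth_on S c" "p \<in> S"
  shows "du (\<lambda>q. vector [a q, b q, c q] :: real ^ 3) p = vector [du a p, du b p, du c p]"
    and "dv (\<lambda>q. vector [a q, b q, c q] :: real ^ 3) p = vector [dv a p, dv b p, dv c p]"
proof -
  have "((\<lambda>q. vector [a q, b q, c q] :: real ^ 3) has_derivative
      (\<lambda>t. vector [frechet_derivative a (at p) t, frechet_derivative b (at p) t,
         frechet_derivative c (at p) t])) (at p)"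
    unfolding vector3_axis
    by (intro has_derivative_add has_derivative_scaleR_left smooth_on_has_derivative[OF assms(1,4)]
        smooth_on_has_derivative[OF assms(2,4)] smooth_on_has_derivative[OF assms(3,4)])
  from du_dv_eq[OF this]
  show "du (\<lambda>q. vector [a q, b q, c q] :: real ^ 3) p = vector [du a p, du b p, du c p]"
    and "dv (\<lambda>q. vector [a q, b q, c q] :: real ^ 3) p = vector [dv a p, dv b p, dv c p]"
    by (simp_all add: du_def dv_def)
qed

lemma du_dv_add_snd_square:
  fixes a b :: "real \<times> real \<Rightarrow> real"
  assumes "smooth_on S a" "smooth_on S b" "p \<in> S"
  shows "du (\<lambda>q. a q + (snd q)\<^sup>2 * b q) p = du a p + (snd p)\<^sup>2 * du b p"
    and "dv (\<lambda>q. a q + (snd q)\<^sup>2 * b q) p = dv a p + snd p * (2 * b p + snd p * dv b p)"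
proof -
  have "((\<lambda>q. a q + (snd q)\<^sup>2 * b q) has_derivative
      (\<lambda>t. frechet_derivative a (at p) t
        + ((snd p)\<^sup>2 * frechet_derivative b (at p) t + 2 * snd p * snd t * b p))) (at p)"
    by (rule derivative_eq_intros smooth_on_has_derivative[OF assms(1,3)]
        smooth_on_has_derivative[OF assms(2,3)] refl)+ (simp add: fun_eq_iff)
  from du_dv_eq[OF this]
  show "du (\<lambda>q. a q + (snd q)\<^sup>2 * b q) p = du a p + (snd p)\<^sup>2 * du b p"
    and "dv (\<lambda>q. a q + (snd q)\<^sup>2 * b q) p = dv a p + snd p * (2 * b p + snd p * dv b p)"
    by (simp_all add: du_def dv_def power2_eq_square algebra_simps)
qed

text \<open>Differentiating a Taylor expansion in \<open>u\<close> with a remainder gives again such an expansion, with a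
  new smooth remainder. The first and the third formula are two successive steps.\<close>

lemma du_dv_taylor:
  fixes k :: "real \<times> real \<Rightarrow> real"
  assumes "smooth_on S k" "p \<in> S"
  shows "du (\<lambda>q. c2 / 2 * (fst q)\<^sup>2 + c3 / 6 * fst q ^ 3 + fst q ^ 4 * k q) p
      = c2 * fst p + c3 / 2 * (fst p)\<^sup>2 + fst p ^ 3 * (4 * k p + fst p * du k p)"
    and "dv (\<lambda>q. c2 / 2 * (fst q)\<^sup>2 + c3 / 6 * fst q ^ 3 + fst q ^ 4 * k q) p = fst p ^ 4 * dv k p"
    and "du (\<lambda>q. c2 * fst q + c3 / 2 * (fst q)\<^sup>2 + fst q ^ 3 * k q) p
      = c2 + c3 * fst p + (fst p)\<^sup>2 * (3 * k p + fst p * du k p)"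
proof -
  note d = derivative_eq_intros smooth_on_has_derivative[OF assms] refl
  have "((\<lambda>q. c2 / 2 * (fst q)\<^sup>2 + c3 / 6 * fst q ^ 3 + fst q ^ 4 * k q) has_derivative
      (\<lambda>t. (c2 * fst p + c3 / 2 * (fst p)\<^sup>2 + 4 * fst p ^ 3 * k p) * fst t
        + fst p ^ 4 * frechet_derivative k (at p) t)) (at p)"
    by (rule d)+ (simp add: fun_eq_iff algebra_simps)
  from du_dv_eq[OF this] show
    "du (\<lambda>q. c2 / 2 * (fst q)\<^sup>2 + c3 / 6 * fst q ^ 3 + fst q ^ 4 * k q) p
      = c2 * fst p + c3 / 2 * (fst p)\<^sup>2 + fst p ^ 3 * (4 * k p + fst p * du k p)"
    "dv (\<lambda>q. c2 / 2 * (fst q)\<^sup>2 + c3 / 6 * fst q ^ 3 + fst q ^ 4 * k q) p = fst p ^ 4 * dv k p"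
    by (simp_all add: du_def dv_def algebra_simps eval_nat_numeral)
  have "((\<lambda>q. c2 * fst q + c3 / 2 * (fst q)\<^sup>2 + fst q ^ 3 * k q) has_derivative
      (\<lambda>t. (c2 + c3 * fst p + 3 * (fst p)\<^sup>2 * k p) * fst t
        + fst p ^ 3 * frechet_derivative k (at p) t)) (at p)"
    by (rule d)+ (simp add: fun_eq_iff algebra_simps)
  from du_dv_eq(1)[OF this] show
    "du (\<lambda>q. c2 * fst q + c3 / 2 * (fst q)\<^sup>2 + fst q ^ 3 * k q) p
      = c2 + c3 * fst p + (fst p)\<^sup>2 * (3 * k p + fst p * du k p)"
    by (simp add: du_def algebra_simps eval_nat_numeral)
qed

text \<open>Terms with a factor \<open>u\<^sup>2\<close> or \<open>v\<^sup>2\<close> have zero derivative at the origin.\<close>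

lemma du_dv_at_0:
  fixes k m :: "real \<times> real \<Rightarrow> real"
  assumes "smooth_on S k" "smooth_on S m" "0 \<in> S"
  shows "du (\<lambda>q. c0 + c1 * fst q + (fst q)\<^sup>2 * k q + (snd q)\<^sup>2 * m q) 0 = c1"
    and "dv (\<lambda>q. c0 + c1 * fst q + (fst q)\<^sup>2 * k q + (snd q)\<^sup>2 * m q) 0 = 0"
proof -
  have "((\<lambda>q. c0 + c1 * fst q + (fst q)\<^sup>2 * k q + (snd q)\<^sup>2 * m q) has_derivative
      (\<lambda>t. c1 * fst t)) (at 0)"
    by (rule derivative_eq_intros smooth_on_has_derivative[OF assms(1,3)]
        smooth_on_has_derivative[OF assms(2,3)] refl)+ (simp add: fun_eq_iff)
  from du_dv_eq[OF this] show
    "du (\<lambda>q. c0 + c1 * fst q + (fst q)\<^sup>2 * k q + (snd q)\<^sup>2 * m q) 0 = c1"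
    "dv (\<lambda>q. c0 + c1 * fst q + (fst q)\<^sup>2 * k q + (snd q)\<^sup>2 * m q) 0 = 0" by simp_all
qed

lemma smooth_on_fst_compose:
  fixes h :: "real \<Rightarrow> real" and U :: "(real \<times> real) set"
  assumes "open U" "smooth_on (fst ` U) h"
  shows "smooth_on U (\<lambda>p. h (fst p))"
  by (rule smooth_on_compose[OF assms(1) _ assms(2) smooth_on_fst[OF assms(1) smooth_on_id[OF assms(1)]]])
    (auto intro: open_image_fst assms)

lemma dv_fst_compose:
  fixes h :: "real \<Rightarrow> real" and U :: "(real \<times> real) set"
  assumes "smooth_on (fst ` U) h" "p \<in> U"
  shows "dv (\<lambda>p. h (fst p)) p = 0"
proof -
  have h: "(h has_derivative frechet_derivative h (at (fst p))) (at (fst p))"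
    using assms by (intro smooth_on_has_derivative) auto
  have "((\<lambda>p. h (fst p)) has_derivative (\<lambda>t. frechet_derivative h (at (fst p)) (fst t))) (at p)"
    by (rule has_derivative_compose[OF has_derivative_fst[OF has_derivative_ident] h])
  from du_dv_eq(2)[OF this] show ?thesis
    using linear_0[OF has_derivative_linear[OF h]] by simp
qed

locale cuspidal_normal_form =
  fixes f :: "real \<times> real \<Rightarrow> real ^ 3" and U :: "(real \<times> real) set"
    and a20 a30 b20 b30 b12 b03 :: real
    and h1 h2 h3 h4 :: "real \<Rightarrow> real" and h5 :: "real \<times> real \<Rightarrow> real"
  assumes open_U: "open U" and zero_in_U: "0 \<in> U"
    and h1: "smooth_on (fst ` U) h1" and h2: "smooth_on (fst ` U) h2"
    and h3: "smooth_on (fst ` U) h3" and h4: "smooth_on (fst ` U) h4"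
    and h5: "smooth_on U h5"
    and f: "\<And>p. p \<in> U \<Longrightarrow>
      f p = normal_form a20 a30 b20 b30 b12 b03 p + remainder h1 h2 h3 h4 h5 p"
begin

text \<open>The coordinates of \<open>f\<close> are \<open>u\<close>, \<open>X + v\<^sup>2/2\<close> and \<open>Z + v\<^sup>2 J\<close>, where \<open>X\<close> and \<open>Z\<close> depend on \<open>u\<close>
  only. Hence \<open>f\<^sub>v\<close> visibly has the factor \<open>v\<close>, and the cofactor is \<open>\<psi>\<close>.\<close>

definition X :: "real \<times> real \<Rightarrow> real" where
  "X p = a20 / 2 * (fst p)\<^sup>2 + a30 / 6 * fst p ^ 3 + fst p ^ 4 * h1 (fst p)"

definition Z :: "real \<times> real \<Rightarrow> real" where
  "Z p = b20 / 2 * (fst p)\<^sup>2 + b30 / 6 * fst p ^ 3 + fst p ^ 4 * h2 (fst p)"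

definition J :: "real \<times> real \<Rightarrow> real" where
  "J p = b12 / 2 * fst p + b03 / 6 * snd p + (fst p)\<^sup>2 * h3 (fst p)
     + fst p * snd p * h4 (fst p) + (snd p)\<^sup>2 * h5 p"

definition \<psi> :: "real \<times> real \<Rightarrow> real ^ 3" where
  "\<psi> p = vector [0, 1, 2 * J p + snd p * dv J p]"

lemma smooth_h: "smooth_on U (\<lambda>p. h1 (fst p))" "smooth_on U (\<lambda>p. h2 (fst p))"
  "smooth_on U (\<lambda>p. h3 (fst p))" "smooth_on U (\<lambda>p. h4 (fst p))"
  by (intro smooth_on_fst_compose open_U h1 h2 h3 h4)+

lemma smooth_XZJ: "smooth_on U X" "smooth_on U Z" "smooth_on U J"
  unfolding X_def[abs_def] Z_def[abs_def] J_def[abs_def]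
  by (intro smooth_on_add smooth_on_mult smooth_on_power smooth_on_fst smooth_on_snd smooth_on_id
      smooth_on_const smooth_h h5 open_U)+

lemma smooth_\<psi>: "smooth_on U \<psi>"
  unfolding \<psi>_def[abs_def]
  by (intro smooth_on_vector3 smooth_on_add smooth_on_mult smooth_on_snd smooth_on_id smooth_on_dv
      smooth_on_const smooth_XZJ open_U)

lemma f_eq: "p \<in> U \<Longrightarrow> f p = vector [fst p, X p + (snd p)\<^sup>2 * (1 / 2), Z p + (snd p)\<^sup>2 * J p]"
  by (cases p) (simp add: f normal_form_def remainder_def X_def Z_def J_def vec_eq_iff forall_3
      algebra_simps eval_nat_numeral)

lemma smooth_components:
  "smooth_on U (\<lambda>p. X p + (snd p)\<^sup>2 * (1 / 2))" "smooth_on U (\<lambda>p. Z p + (snd p)\<^sup>2 * J p)"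
  by (intro smooth_on_add smooth_on_mult smooth_on_power smooth_on_snd smooth_on_id
      smooth_on_const smooth_XZJ open_U)+

lemma smooth_f: "smooth_on U f"
  by (rule smooth_on_cong[OF open_U smooth_on_vector3[OF open_U smooth_on_fst[OF open_U smooth_on_id[OF open_U]]
      smooth_components]]) (simp add: f_eq)

lemma du_dv_f:
  assumes "p \<in> U"
  shows "du f p = vector [1, du X p, du Z p + (snd p)\<^sup>2 * du J p]"
    and "dv f p = snd p *\<^sub>R \<psi> p"
proof -
  note v = smooth_on_fst[OF open_U smooth_on_id[OF open_U]] smooth_components assms
  have c: "smooth_on U (\<lambda>p. 1 / 2 :: real)" by (rule smooth_on_const[OF open_U])
  have fst: "du fst p = (1::real)" "dv fst p = (0::real)"
    using du_dv_eq[OF has_derivative_fst[OF has_derivative_ident]] by auto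
  have const: "du (\<lambda>p. 1 / 2 :: real) p = 0" "dv (\<lambda>p. 1 / 2 :: real) p = 0"
    by (rule du_dv_eq[OF has_derivative_const])+
  have XZ: "dv X p = 0" "dv Z p = 0"
    unfolding X_def[abs_def] Z_def[abs_def] du_dv_taylor(2)[OF smooth_h(1) assms]
      du_dv_taylor(2)[OF smooth_h(2) assms] dv_fst_compose[OF h1 assms] dv_fst_compose[OF h2 assms]
    by simp_all
  have eqs: "du f p = du (\<lambda>p. vector [fst p, X p + (snd p)\<^sup>2 * (1 / 2), Z p + (snd p)\<^sup>2 * J p]) p"
    "dv f p = dv (\<lambda>p. vector [fst p, X p + (snd p)\<^sup>2 * (1 / 2), Z p + (snd p)\<^sup>2 * J p]) p"
    by (rule du_dv_cong[OF open_U assms f_eq smooth_on_vector3[OF open_U v(1-3)]]; assumption)+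
  show "du f p = vector [1, du X p, du Z p + (snd p)\<^sup>2 * du J p]"
    unfolding eqs du_dv_vector3[OF v] du_dv_add_snd_square[OF smooth_XZJ(1) c assms]
      du_dv_add_snd_square[OF smooth_XZJ(2,3) assms] by (simp add: fst const)
  show "dv f p = snd p *\<^sub>R \<psi> p"
    unfolding eqs du_dv_vector3[OF v] du_dv_add_snd_square[OF smooth_XZJ(1) c assms]
      du_dv_add_snd_square[OF smooth_XZJ(2,3) assms]
    by (simp add: fst const XZ \<psi>_def vec_eq_iff forall_3)
qed

lemma du_du_f:
  obtains K1 K2 where "smooth_on U K1" "smooth_on U K2"
    "\<And>p. p \<in> U \<Longrightarrow> du (du f) p = vector [0, a20 + a30 * fst p + (fst p)\<^sup>2 * K1 p,
       b20 + b30 * fst p + (fst p)\<^sup>2 * K2 p + (snd p)\<^sup>2 * du (du J) p]"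
proof -
  define k1 where "k1 p = 4 * h1 (fst p) + fst p * du (\<lambda>p. h1 (fst p)) p" for p :: "real \<times> real"
  define k2 where "k2 p = 4 * h2 (fst p) + fst p * du (\<lambda>p. h2 (fst p)) p" for p :: "real \<times> real"
  define K1 where "K1 p = 3 * k1 p + fst p * du k1 p" for p
  define K2 where "K2 p = 3 * k2 p + fst p * du k2 p" for p
  have sk: "smooth_on U k1" "smooth_on U k2"
    unfolding k1_def k2_def
    by (intro smooth_on_add smooth_on_mult smooth_on_fst smooth_on_id smooth_on_const
        smooth_on_du smooth_h open_U)+
  have sK: "smooth_on U K1" "smooth_on U K2"
    unfolding K1_def K2_def
    by (intro smooth_on_add smooth_on_mult smooth_on_fst smooth_on_id smooth_on_const
        smooth_on_du sk open_U)+
  have s: "smooth_on U (\<lambda>p. c * fst p + d / 2 * (fst p)\<^sup>2 + fst p ^ 3 * k p)"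
    if "smooth_on U k" for c d :: real and k
    by (intro smooth_on_add smooth_on_mult smooth_on_fst smooth_on_id smooth_on_const smooth_on_power
        that open_U)
  have duX: "du X p = a20 * fst p + a30 / 2 * (fst p)\<^sup>2 + fst p ^ 3 * k1 p"
    and duZ: "du Z p = b20 * fst p + b30 / 2 * (fst p)\<^sup>2 + fst p ^ 3 * k2 p" if "p \<in> U" for p
    unfolding X_def[abs_def] Z_def[abs_def] du_dv_taylor(1)[OF smooth_h(1) that]
      du_dv_taylor(1)[OF smooth_h(2) that] k1_def k2_def by simp_all
  have duduX: "du (du X) p = a20 + a30 * fst p + (fst p)\<^sup>2 * K1 p"
    and duduZ: "du (du Z) p = b20 + b30 * fst p + (fst p)\<^sup>2 * K2 p" if "p \<in> U" for p
  proof -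
    have "du (du X) p = du (\<lambda>p. a20 * fst p + a30 / 2 * (fst p)\<^sup>2 + fst p ^ 3 * k1 p) p"
      "du (du Z) p = du (\<lambda>p. b20 * fst p + b30 / 2 * (fst p)\<^sup>2 + fst p ^ 3 * k2 p) p"
      by (rule du_dv_cong(1)[OF open_U that duX s[OF sk(1)]] du_dv_cong(1)[OF open_U that duZ s[OF sk(2)]];
          assumption)+
    then show "du (du X) p = a20 + a30 * fst p + (fst p)\<^sup>2 * K1 p"
      "du (du Z) p = b20 + b30 * fst p + (fst p)\<^sup>2 * K2 p"
      unfolding du_dv_taylor(3)[OF sk(1) that] du_dv_taylor(3)[OF sk(2) that] K1_def K2_def by simp_all
  qed
  have "du (du f) p = vector [0, a20 + a30 * fst p + (fst p)\<^sup>2 * K1 p,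
       b20 + b30 * fst p + (fst p)\<^sup>2 * K2 p + (snd p)\<^sup>2 * du (du J) p]" if p: "p \<in> U" for p
  proof -
    have v: "smooth_on U (\<lambda>p. 1 :: real)" "smooth_on U (du X)"
      "smooth_on U (\<lambda>p. du Z p + (snd p)\<^sup>2 * du J p)"
      by (intro smooth_on_add smooth_on_mult smooth_on_snd smooth_on_id smooth_on_const smooth_on_power
        smooth_on_du smooth_XZJ open_U)+
    have const: "du (\<lambda>p. 1 :: real) p = 0"
      by (rule du_dv_eq[OF has_derivative_const])
    have "du (du f) p = du (\<lambda>p. vector [1, du X p, du Z p + (snd p)\<^sup>2 * du J p]) p"
      by (rule du_dv_cong(1)[OF open_U p du_dv_f(1) smooth_on_vector3[OF open_U v]])
    then show ?thesis
      unfolding du_dv_vector3(1)[OF v p]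
        du_dv_add_snd_square(1)[OF smooth_on_du[OF smooth_XZJ(2)] smooth_on_du[OF smooth_XZJ(3)] p]
        duduX[OF p] duduZ[OF p] const .
  qed
  with that[OF sK] show ?thesis by blast
qed

lemma J_at_0: "J 0 = 0" "du J 0 = b12 / 2" "dv J 0 = b03 / 6"
proof -
  show "J 0 = 0" by (simp add: J_def)
  note d = smooth_on_has_derivative[OF smooth_h(3) zero_in_U]
    smooth_on_has_derivative[OF smooth_h(4) zero_in_U] smooth_on_has_derivative[OF h5 zero_in_U]
  have "(J has_derivative (\<lambda>t. b12 / 2 * fst t + b03 / 6 * snd t)) (at 0)"
    unfolding J_def[abs_def]
    by (rule derivative_eq_intros d refl)+ (simp add: fun_eq_iff)
  from du_dv_eq[OF this] show "du J 0 = b12 / 2" "dv J 0 = b03 / 6" by simp_all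
qed

lemma \<psi>_at_0: "\<psi> 0 = vector [0, 1, 0]" "du \<psi> 0 = vector [0, 0, b12]" "dv \<psi> 0 = vector [0, 0, b03 / 2]"
proof -
  show "\<psi> 0 = vector [0, 1, 0]" by (simp add: \<psi>_def J_at_0)
  have s: "smooth_on U (\<lambda>p. 0 :: real)" "smooth_on U (\<lambda>p. 1 :: real)"
    "smooth_on U (\<lambda>p. 2 * J p + snd p * dv J p)"
    by (intro smooth_on_add smooth_on_mult smooth_on_snd smooth_on_id smooth_on_const
        smooth_on_dv smooth_XZJ open_U)+
  have const: "du (\<lambda>p. c :: real) (0 :: real \<times> real) = 0" "dv (\<lambda>p. c :: real) (0 :: real \<times> real) = 0" for c
    by (rule du_dv_eq[OF has_derivative_const])+
  have "((\<lambda>p. 2 * J p + snd p * dv J p) has_derivative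
      (\<lambda>t. 2 * frechet_derivative J (at 0) t + snd t * dv J 0)) (at 0)"
    by (rule derivative_eq_intros smooth_on_has_derivative[OF smooth_XZJ(3) zero_in_U]
        smooth_on_has_derivative[OF smooth_on_dv[OF smooth_XZJ(3)] zero_in_U] refl)+
      (simp add: fun_eq_iff)
  from du_dv_eq[OF this]
  have dJ: "du (\<lambda>p. 2 * J p + snd p * dv J p) 0 = b12" "dv (\<lambda>p. 2 * J p + snd p * dv J p) 0 = b03 / 2"
    unfolding du_def[symmetric] dv_def[symmetric] J_at_0 by simp_all
  show "du \<psi> 0 = vector [0, 0, b12]" "dv \<psi> 0 = vector [0, 0, b03 / 2]"
    unfolding \<psi>_def[abs_def] du_dv_vector3[OF s zero_in_U] const dJ by (rule refl)+
qed

lemma du_f_at_0: "du f 0 = vector [1, 0, 0]"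
  unfolding du_dv_f(1)[OF zero_in_U] X_def[abs_def] Z_def[abs_def]
    du_dv_taylor(1)[OF smooth_h(1) zero_in_U] du_dv_taylor(1)[OF smooth_h(2) zero_in_U] by simp

text \<open>The part of \<open>U\<close> on which the unit normal is defined.\<close>

definition W :: "(real \<times> real) set" where
  "W = U \<inter> {p. cross3 (du f p) (\<psi> p) \<noteq> 0}"

lemma cross_at_0: "cross3 (du f 0) (\<psi> 0) = vector [0, 0, 1]"
  by (simp add: du_f_at_0 \<psi>_at_0 cross3_def)

lemma zero_in_W: "0 \<in> W"
  by (simp add: W_def zero_in_U cross_at_0 vec_eq_iff forall_3)

sublocale axis_singular_front f \<psi> W
proof
  have sub: "W \<subseteq> U" by (auto simp: W_def)
  have "smooth_on U (\<lambda>p. cross3 (du f p) (\<psi> p))"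
    by (intro smooth_on_cross3 smooth_on_du smooth_f smooth_\<psi> open_U)
  from continuous_open_preimage[OF smooth_on_imp_continuous_on[OF this] open_U, of "- {0}"]
  show "open W" by (auto simp: W_def vimage_def Int_def)
  show "smooth_on W f" "smooth_on W \<psi>"
    by (rule smooth_on_subset[OF smooth_f sub] smooth_on_subset[OF smooth_\<psi> sub])+
  show "dv f p = snd p *\<^sub>R \<psi> p" "cross3 (du f p) (\<psi> p) \<noteq> 0" if "p \<in> W" for p
    using that by (auto simp: W_def du_dv_f)
qed

lemma nu_at_0: "nu f 0 = vector [0, 0, 1]"
proof -
  have "norm (vector [0, 0, 1] :: real ^ 3) = 1"
    by (simp add: norm_eq_sqrt_inner inner_vector3)
  then show ?thesis by (simp add: nu_def psi_eq[OF zero_in_W] cross_at_0)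
qed

lemma coefficients_at_0:
  shows "E_hat f 0 = 1" "F_hat f 0 = 0" "L_hat f 0 = b20" "M_hat f 0 = b12" "N_hat f 0 = b03 / 2"
proof -
  obtain K1 K2 where duduf: "\<And>p. p \<in> U \<Longrightarrow> du (du f) p =
      vector [0, a20 + a30 * fst p + (fst p)\<^sup>2 * K1 p,
       b20 + b30 * fst p + (fst p)\<^sup>2 * K2 p + (snd p)\<^sup>2 * du (du J) p]"
    by (rule du_du_f) blast
  have psi: "psi f 0 = \<psi> 0" by (rule psi_eq[OF zero_in_W])
  have dpsi: "du (psi f) 0 = du \<psi> 0" "dv (psi f) 0 = dv \<psi> 0"
    by (rule du_dv_cong[where g = "psi f", OF open_W zero_in_W psi_eq axis_singular_front.smooth_\<psi>[OF axis_singular_front_axioms]];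
        assumption)+
  show "E_hat f 0 = 1" "F_hat f 0 = 0"
    by (simp_all add: E_hat_def F_hat_def du_f_at_0 psi \<psi>_at_0 inner_vector3)
  show "L_hat f 0 = b20" "M_hat f 0 = b12" "N_hat f 0 = b03 / 2"
    by (simp_all add: fundamental_coefficients[OF zero_in_W] duduf[OF zero_in_U] dpsi \<psi>_at_0 nu_at_0
        inner_vector3)
qed

text \<open>Both follow from \<open>L = f\<^sub>u\<^sub>u \<bullet> \<nu>\<close>. At the origin \<open>f\<^sub>u\<^sub>u = a\<^sub>2\<^sub>0 \<psi>\<close>, so the derivatives of \<open>\<nu>\<close>
  enter only through \<open>\<psi> \<bullet> \<nu>\<^sub>u = - M\<close> and \<open>\<psi> \<bullet> \<nu>\<^sub>v = - N\<close>.\<close>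

lemma L_derivatives_at_0:
  assumes "b20 = 0"
  shows "du (L_hat f) 0 = b30 - a20 * b12" and "dv (L_hat f) 0 = - a20 * b03 / 2"
proof -
  obtain K1 K2 where K: "smooth_on U K1" "smooth_on U K2"
    and duduf: "\<And>p. p \<in> U \<Longrightarrow> du (du f) p =
      vector [0, a20 + a30 * fst p + (fst p)\<^sup>2 * K1 p,
       b20 + b30 * fst p + (fst p)\<^sup>2 * K2 p + (snd p)\<^sup>2 * du (du J) p]"
    by (rule du_du_f) blast
  let ?a = "\<lambda>p. a20 + a30 * fst p + (fst p)\<^sup>2 * K1 p"
  let ?b = "\<lambda>p. b20 + b30 * fst p + (fst p)\<^sup>2 * K2 p + (snd p)\<^sup>2 * du (du J) p"
  have s: "smooth_on U (\<lambda>p. 0 :: real)" "smooth_on U ?a" "smooth_on U ?b"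
    by (intro smooth_on_add smooth_on_mult smooth_on_fst smooth_on_snd smooth_on_power smooth_on_id
        smooth_on_const smooth_on_du smooth_XZJ K open_U)+
  have dudu: "du (du (du f)) 0 = du (\<lambda>p. vector [0, ?a p, ?b p]) 0"
    "dv (du (du f)) 0 = dv (\<lambda>p. vector [0, ?a p, ?b p]) 0"
    by (rule du_dv_cong[OF open_U zero_in_U duduf smooth_on_vector3[OF open_U s]]; assumption)+
  have ddd: "du (du (du f)) 0 = vector [du (\<lambda>p. 0) (0 :: real \<times> real), du ?a 0, b30]"
    "dv (du (du f)) 0 = vector [dv (\<lambda>p. 0) (0 :: real \<times> real), dv ?a 0, 0]"
    unfolding dudu du_dv_vector3[OF s zero_in_U]
      du_dv_at_0[OF K(2) smooth_on_du[OF smooth_on_du[OF smooth_XZJ(3)]] zero_in_U] by simp_all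
  have psi: "psi f 0 = vector [0, 1, 0]" by (simp add: psi_eq[OF zero_in_W] \<psi>_at_0)
  have dudu0: "du (du f) 0 = a20 *\<^sub>R psi f 0"
    using duduf[OF zero_in_U] by (simp add: assms psi vec_eq_iff forall_3)
  have nu2: "psi f 0 \<bullet> du (nu f) 0 = - b12" "psi f 0 \<bullet> dv (nu f) 0 = - (b03 / 2)"
    using coefficients_at_0(4,5) unfolding M_hat_def N_hat_def by linarith+
  note smW = smooth_on_du[OF smooth_on_du[OF axis_singular_front.smooth_f[OF axis_singular_front_axioms]]]
  have L: "du (L_hat f) 0 = du (\<lambda>p. du (du f) p \<bullet> nu f p) 0"
    "dv (L_hat f) 0 = dv (\<lambda>p. du (du f) p \<bullet> nu f p) 0"
    by (rule du_dv_cong[OF open_W zero_in_W fundamental_coefficients(1)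
        smooth_on_inner[OF open_W smW smooth_nu]]; assumption)+
  show "du (L_hat f) 0 = b30 - a20 * b12" "dv (L_hat f) 0 = - a20 * b03 / 2"
    unfolding L du_dv_inner[OF smW smooth_nu zero_in_W] ddd dudu0 nu_at_0
    by (simp_all add: inner_vector3 nu2)
qed

text \<open>The terms \<open>- N\<^sup>2 a\<^sub>2\<^sub>0 M\<close> and \<open>N M a\<^sub>2\<^sub>0 N\<close> coming from \<open>L\<^sub>u\<close> and \<open>L\<^sub>v\<close> cancel, which is why
  the condition involves the third coordinate alone.\<close>

lemma kappa2_and_ridge:
  assumes "b03 > 0"
  shows "kappa2_hat f 0 = b20"
    and "b20 = 0 \<Longrightarrow> ridge_point f 0 \<longleftrightarrow> 4 * b12 ^ 3 + b30 * b03\<^sup>2 = 0"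
proof -
  have A: "A_hat f 0 = b03 / 2" "A_hat f 0 > 0"
    using assms by (simp_all add: A_at_0 coefficients_at_0)
  show kappa: "kappa2_hat f 0 = b20"
    using kappa2_at_0[OF zero_in_W A(2)] by (simp add: coefficients_at_0)
  assume b20: "b20 = 0"
  have dir: "principal_direction f 0 = (b03 / 2, - b12)"
    by (simp add: principal_direction_def coefficients_at_0)
  have "frechet_derivative (kappa2_hat f) (at 0) (principal_direction f 0)
      = (4 * b12 ^ 3 + b30 * b03\<^sup>2) / (2 * b03)"
    using assms
    by (simp add: kappa2_derivative_at_0[OF zero_in_W A(2)] dir coefficients_at_0 L_derivatives_at_0 b20 A(1)
        field_simps power2_eq_square power3_eq_cube)
  then show "ridge_point f 0 \<longleftrightarrow> 4 * b12 ^ 3 + b30 * b03\<^sup>2 = 0"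
    using assms by (simp add: ridge_point_def)
qed

lemma height_function_eq:
  assumes "p \<in> U"
  shows "height_function f c p = b20 / 2 * (fst p)\<^sup>2 + (b30 / 6 + fst p * h2 (fst p)) * fst p ^ 3
    + (b12 / 2 + fst p * h3 (fst p)) * fst p * (snd p)\<^sup>2
    + (b03 / 6 + fst p * h4 (fst p) + snd p * h5 p) * snd p ^ 3"
proof -
  have "height_function f c p = f p \<bullet> nu f 0 - f 0 \<bullet> nu f 0"
    by (simp add: height_function_def Let_def inner_add_left)
  also have "\<dots> = Z p + (snd p)\<^sup>2 * J p"
    by (simp add: f_eq[OF assms] f_eq[OF zero_in_U] nu_at_0 inner_vector3) (simp add: Z_def)
  finally show ?thesis by (simp add: Z_def J_def algebra_simps eval_nat_numeral)
qed

text \<open>The discriminant of the cubic part is \<open>(4 b\<^sub>1\<^sub>2\<^sup>3 + b\<^sub>3\<^sub>0 b\<^sub>0\<^sub>3\<^sup>2) / 8\<close> up to the factor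
  \<open>- b\<^sub>3\<^sub>0 / 6\<close>.\<close>

lemma D4_singularity_height_function:
  assumes "b03 \<noteq> 0"
  shows "D4_singularity_at_0 (height_function f c) \<longleftrightarrow>
    b20 = 0 \<and> b30 \<noteq> 0 \<and> 4 * b12 ^ 3 + b30 * b03\<^sup>2 \<noteq> 0"
proof -
  define P where "P p = b30 / 6 + fst p * h2 (fst p)" for p :: "real \<times> real"
  define Q where "Q p = b12 / 2 + fst p * h3 (fst p)" for p :: "real \<times> real"
  define R where "R p = b03 / 6 + fst p * h4 (fst p) + snd p * h5 p" for p :: "real \<times> real"
  have sm: "smooth_on U P" "smooth_on U Q" "smooth_on U R"
    unfolding P_def Q_def R_def
    by (intro smooth_on_add smooth_on_mult smooth_on_fst smooth_on_snd smooth_on_id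
      smooth_on_const smooth_h h5 open_U)+
  have height: "height_function f c p = b20 / 2 * (fst p)\<^sup>2 + P p * fst p ^ 3
    + Q p * fst p * (snd p)\<^sup>2 + R p * snd p ^ 3" if "p \<in> U" for p
    unfolding height_function_eq[OF that] P_def Q_def R_def ..
  have disc: "4 * Q 0 ^ 3 + 27 * P 0 * (R 0)\<^sup>2 = (4 * b12 ^ 3 + b30 * b03\<^sup>2) / 8"
    by (simp add: P_def Q_def R_def power2_eq_square power3_eq_cube)
  have P0: "P 0 = b30 / 6" and R0: "R 0 = b03 / 6" by (simp_all add: P_def R_def)
  show ?thesis
  proof
    assume D4: "D4_singularity_at_0 (height_function f c)"
    have cont: "isCont P 0" "isCont Q 0" "isCont R 0"
      using smooth_on_imp_continuous_on[OF sm(1)] smooth_on_imp_continuous_on[OF sm(2)]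
        smooth_on_imp_continuous_on[OF sm(3)] zero_in_U
      unfolding continuous_on_eq_continuous_at[OF open_U] by blast+
    have "\<forall>\<^sub>F p in nhds 0. p \<in> U" using open_U zero_in_U by (rule eventually_nhds_in_open)
    then have "\<forall>\<^sub>F p in nhds 0. height_function f c p = b20 / 2 * (fst p)\<^sup>2 + P p * fst p ^ 3
        + Q p * fst p * (snd p)\<^sup>2 + R p * snd p ^ 3"
      by eventually_elim (rule height)
    moreover have "R 0 \<noteq> 0" using assms by (simp add: R0)
    ultimately have cubic: "b20 / 2 = 0" "P 0 \<noteq> 0" "4 * Q 0 ^ 3 + 27 * P 0 * (R 0)\<^sup>2 \<noteq> 0"
      by (rule D4_singularity_imp_cubic[OF D4 cont])+
    show "b20 = 0 \<and> b30 \<noteq> 0 \<and> 4 * b12 ^ 3 + b30 * b03\<^sup>2 \<noteq> 0"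
      using cubic(1,2) cubic(3)[unfolded disc] by (simp add: P0)
  next
    assume *: "b20 = 0 \<and> b30 \<noteq> 0 \<and> 4 * b12 ^ 3 + b30 * b03\<^sup>2 \<noteq> 0"
    show "D4_singularity_at_0 (height_function f c)"
    proof (rule D4_singularity_of_cubic[OF open_U zero_in_U sm])
      show "4 * Q 0 ^ 3 + 27 * P 0 * (R 0)\<^sup>2 \<noteq> 0" unfolding disc using * by simp
    qed (use * in \<open>simp_all add: P0 height\<close>)
  qed
qed

end

theorem lemma4p1:
  fixes f :: "real \<times> real \<Rightarrow> real ^ 3"
    and U :: "(real \<times> real) set"
    and a20 a30 b20 b30 b12 b03 :: real
    and h1 h2 h3 h4 :: "real \<Rightarrow> real"
    and h5 :: "real \<times> real \<Rightarrow> real"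
    and c :: "real ^ 3"
  assumes "open U" and "0 \<in> U"
    and "smooth_on (fst ` U) h1" and "smooth_on (fst ` U) h2"
    and "smooth_on (fst ` U) h3" and "smooth_on (fst ` U) h4"
    and "smooth_on U h5"
    and "\<And>p. p \<in> U \<Longrightarrow>
           f p = normal_form a20 a30 b20 b30 b12 b03 p + remainder h1 h2 h3 h4 h5 p"
    and "b20 \<ge> 0" and "b03 \<noteq> 0"
    and "cuspidal_edge_at f 0"
    and "\<And>u. (u, 0) \<in> U \<Longrightarrow> N_hat f (u, 0) > 0"
    and "c \<noteq> 0" and "nu f 0 \<bullet> c \<noteq> 0"
  shows "D4_singularity_at_0 (height_function f c) \<longleftrightarrow>
           kappa2_hat f 0 = 0 \<and> b30 \<noteq> 0 \<and> \<not> ridge_point f 0"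
proof -
  interpret cuspidal_normal_form f U a20 a30 b20 b30 b12 b03 h1 h2 h3 h4 h5
    by standard (fact assms)+
  have "N_hat f 0 > 0"
    using assms(12)[of 0] \<open>0 \<in> U\<close> by (simp add: zero_prod_def)
  then have "b03 > 0" by (simp add: coefficients_at_0)
  then show ?thesis
    using D4_singularity_height_function[OF \<open>b03 \<noteq> 0\<close>] kappa2_and_ridge by auto
qed

end
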